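(* Let $f(z_1,\dots,z_n)$ be a holomorphic function (in a neighborhood of the origin of $\mathbb{C}^n$) whose multiplicity at the origin is $m\geq 2$. Let $X:=\bigl(xy=f(z_1,\dots,z_n)\bigr)\subset\mathbb{C}^{n+2}$ and assume that $\dim X\geq 2$. Then: (1) $\widehat{\operatorname{Arc}}(0\in X)$ has exactly $m-1$ irreducible components $\widehat{\operatorname{Arc}}_i(0\in X)$, $0<i<m$. (2) There are dense open subsets $\widehat{\operatorname{Arc}}_i^{\circ}(0\in X)\subset\widehat{\operatorname{Arc}}_i(0\in X)$ such that a formal arc $\bigl(\psi_1(t),\psi_2(t),\phi_1(t),\dots,\phi_n(t)\bigr)$ through $0\in X$ lies in $\widehat{\operatorname{Arc}}_i^{\circ}(0\in X)$ if and only if $\operatorname{mult}\psi_1(t)=i$, $\operatorname{mult}\psi_2(t)=m-i$ and $\operatorname{mult} f\bigl(\phi_1(t),\dots,\phi_n(t)\bigr)=m$.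
   Context: For a complex variety or analytic space $X$ and a point $x\in X$, a formal arc through $x$ is a morphism $\phi:\operatorname{Spec}\mathbb{C}[[t]]\to X$ with $\phi(0)=x$. The set of formal arcs through $x$, denoted $\widehat{\operatorname{Arc}}(x\in X)$, is naturally a (non-noetherian) scheme; irreducible components and open sets refer to its Zariski topology. For $X=(xy=f(z_1,\dots,z_n))$ with coordinates $(x,y,z_1,\dots,z_n)$, a formal arc through the origin is a tuple $(\psi_1(t),\psi_2(t),\phi_1(t),\dots,\phi_n(t))$ of power series without constant term satisfying $\psi_1(t)\psi_2(t)=f(\phi_1(t),\dots,\phi_n(t))$. For a power series in $t$, $\operatorname{mult}$ denotes its order of vanishing at $t=0$; the multiplicity of $f$ at the origin is the lowest degree of a monomial appearing in its Taylor expansion. *)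

theory Defs
  imports
    "HOL-Analysis.Analysis"
    "HOL-Computational_Algebra.Formal_Power_Series"
    "HOL-Library.Extended_Nat"
    "HOL-Library.Poly_Mapping"
begin

section \<open>Holomorphic functions of several variables and their Taylor expansion\<close>

definition holomorphic_several_on ::
    "(complex ^ 'n \<Rightarrow> complex) \<Rightarrow> (complex ^ 'n) set \<Rightarrow> bool" where
  "holomorphic_several_on f U \<longleftrightarrow>
     (\<forall>z\<in>U. \<exists>D. (f has_derivative D) (at z) \<and> (\<forall>c v. D (c *s v) = c * D v))"

definition partial_deriv :: "'n \<Rightarrow> (complex ^ 'n \<Rightarrow> complex) \<Rightarrow> (complex ^ 'n \<Rightarrow> complex)" where
  "partial_deriv i f = (\<lambda>z. deriv (\<lambda>w. f (z + axis i w)) 0)"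

text \<open>The coefficient of \<open>z\<^sup>\<alpha>\<close> in the Taylor series at the origin, i.e.
  \<open>\<partial>\<^sup>\<alpha>f(0) / \<alpha>!\<close>. The list fixes an order of differentiation, which is immaterial for
  functions that are holomorphic near the origin.\<close>

definition taylor_coeff :: "(complex ^ 'n \<Rightarrow> complex) \<Rightarrow> ('n \<Rightarrow> nat) \<Rightarrow> complex" where
  "taylor_coeff f \<alpha> =
     foldr partial_deriv (SOME is. \<forall>i. count_list is i = \<alpha> i) f 0 / (\<Prod>i\<in>UNIV. fact (\<alpha> i))"

definition mdegree :: "('n::finite \<Rightarrow> nat) \<Rightarrow> nat" where
  "mdegree \<alpha> = (\<Sum>i\<in>UNIV. \<alpha> i)"

text \<open>The infimum of the empty set is \<open>\<infinity>\<close>: this is the value when the Taylor series vanishes.\<close>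

definition multiplicity_at_origin :: "(complex ^ 'n \<Rightarrow> complex) \<Rightarrow> enat" where
  "multiplicity_at_origin f = (INF \<alpha>\<in>{\<alpha>. taylor_coeff f \<alpha> \<noteq> 0}. enat (mdegree \<alpha>))"


section \<open>Formal arcs\<close>

text \<open>Substitution of power series \<open>\<phi>\<^sub>i(t)\<close> without constant term into the power series
  \<open>\<Sum>\<^sub>\<alpha> c\<^sub>\<alpha> z\<^sup>\<alpha>\<close>. As \<open>t\<^sup>k\<close> divides \<open>\<phi>\<^sup>\<alpha>\<close> whenever \<open>|\<alpha>| \<ge> k\<close>, only the finitely
  many \<open>\<alpha>\<close> with \<open>|\<alpha>| \<le> k\<close> contribute to the coefficient of \<open>t\<^sup>k\<close>.\<close>

definition subst_series ::
    "(('n::finite \<Rightarrow> nat) \<Rightarrow> 'a::comm_ring_1) \<Rightarrow> 'a fps ^ 'n \<Rightarrow> 'a fps" where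
  "subst_series c \<phi> =
     Abs_fps (\<lambda>k. \<Sum>\<alpha> | mdegree \<alpha> \<le> k. c \<alpha> * fps_nth (\<Prod>i\<in>UNIV. (\<phi> $ i) ^ \<alpha> i) k)"

abbreviation compose_arc :: "(complex ^ 'n \<Rightarrow> complex) \<Rightarrow> complex fps ^ 'n \<Rightarrow> complex fps" where
  "compose_arc f \<phi> \<equiv> subst_series (taylor_coeff f) \<phi>"

type_synonym 'n arc = "complex fps \<times> complex fps \<times> (complex fps ^ 'n)"

text \<open>Formal arcs through the origin of \<open>xy = f(z)\<close>.\<close>

definition formal_arcs :: "(complex ^ 'n \<Rightarrow> complex) \<Rightarrow> 'n arc set" where
  "formal_arcs f = {(\<psi>1, \<psi>2, \<phi>).
     fps_nth \<psi>1 0 = 0 \<and> fps_nth \<psi>2 0 = 0 \<and> (\<forall>i. fps_nth (\<phi> $ i) 0 = 0) \<and>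
     \<psi>1 * \<psi>2 = compose_arc f \<phi>}"


section \<open>The scheme of formal arcs\<close>

text \<open>The arc scheme is affine: it is the spectrum of the polynomial ring over \<open>\<complex>\<close> in the
  coefficients of an arc modulo the coefficients of the equation \<open>\<psi>\<^sub>1\<psi>\<^sub>2 - f(\<phi>)\<close>.
  Since constant terms vanish, the variable with index \<open>k\<close> stands for the coefficient of
  \<open>t\<^sup>k\<^sup>+\<^sup>1\<close>.\<close>

datatype 'n arc_var = Psi1 nat | Psi2 nat | Phi 'n nat

type_synonym 'v cpoly = "('v \<Rightarrow>\<^sub>0 nat) \<Rightarrow>\<^sub>0 complex"

definition cpoly_const :: "complex \<Rightarrow> 'v cpoly" where
  "cpoly_const c = Poly_Mapping.single 0 c"

definition cpoly_var :: "'v \<Rightarrow> 'v cpoly" where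
  "cpoly_var v = Poly_Mapping.single (Poly_Mapping.single v 1) 1"

definition cpoly_eval :: "('v \<Rightarrow> complex) \<Rightarrow> 'v cpoly \<Rightarrow> complex" where
  "cpoly_eval \<sigma> p = (\<Sum>\<mu>\<in>Poly_Mapping.keys p.
     Poly_Mapping.lookup p \<mu> * (\<Prod>v\<in>Poly_Mapping.keys \<mu>. \<sigma> v ^ Poly_Mapping.lookup \<mu> v))"

definition generic_series :: "(nat \<Rightarrow> 'v) \<Rightarrow> 'v cpoly fps" where
  "generic_series x = fps_X * Abs_fps (\<lambda>k. cpoly_var (x k))"

definition arc_equation :: "(complex ^ 'n \<Rightarrow> complex) \<Rightarrow> 'n arc_var cpoly fps" where
  "arc_equation f =
     generic_series Psi1 * generic_series Psi2 -
     subst_series (\<lambda>\<alpha>. cpoly_const (taylor_coeff f \<alpha>)) (\<chi> i. generic_series (Phi i))"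

definition prime_ideal :: "'a::comm_ring_1 set \<Rightarrow> bool" where
  "prime_ideal P \<longleftrightarrow>
     0 \<in> P \<and> (\<forall>a\<in>P. \<forall>b\<in>P. a + b \<in> P) \<and> (\<forall>a. \<forall>b\<in>P. a * b \<in> P) \<and>
     1 \<notin> P \<and> (\<forall>a b. a * b \<in> P \<longrightarrow> a \<in> P \<or> b \<in> P)"

text \<open>\<open>spec_mod E\<close> is the spectrum, with its Zariski topology, of the ambient ring modulo the
  ideal generated by \<open>E\<close>. Its points are represented by the prime ideals of the ambient ring
  that contain \<open>E\<close>.\<close>

definition spec_points :: "'a::comm_ring_1 set \<Rightarrow> 'a set set" where
  "spec_points E = {P. prime_ideal P \<and> E \<subseteq> P}"

definition spec_mod :: "'a::comm_ring_1 set \<Rightarrow> 'a set topology" where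
  "spec_mod E = topology (\<lambda>U. \<exists>S. U = {P \<in> spec_points E. \<not> S \<subseteq> P})"

lemma istopology_spec_mod:
  "istopology (\<lambda>U. \<exists>S. U = {P \<in> spec_points (E :: 'a::comm_ring_1 set). \<not> S \<subseteq> P})"
  unfolding istopology_def
proof (intro conjI allI impI)
  fix U V :: "'a set set"
  assume "\<exists>S. U = {P \<in> spec_points E. \<not> S \<subseteq> P}" and "\<exists>S. V = {P \<in> spec_points E. \<not> S \<subseteq> P}"
  then obtain S T where U: "U = {P \<in> spec_points E. \<not> S \<subseteq> P}" and V: "V = {P \<in> spec_points E. \<not> T \<subseteq> P}"
    by blast
  have "(\<not> S \<subseteq> P \<and> \<not> T \<subseteq> P) \<longleftrightarrow> \<not> {a * b | a b. a \<in> S \<and> b \<in> T} \<subseteq> P"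
    if "P \<in> spec_points E" for P
  proof -
    have absorb: "\<And>a b. b \<in> P \<Longrightarrow> a * b \<in> P" and prime: "\<And>a b. a * b \<in> P \<Longrightarrow> a \<in> P \<or> b \<in> P"
      using that by (auto simp: spec_points_def prime_ideal_def)
    have "a * b \<in> P" if "a \<in> P" for a b
      using absorb[OF that, of b] by (simp add: mult.commute)
    with absorb prime show ?thesis by blast
  qed
  hence "U \<inter> V = {P \<in> spec_points E. \<not> {a * b | a b. a \<in> S \<and> b \<in> T} \<subseteq> P}"
    unfolding U V by blast
  thus "\<exists>S. U \<inter> V = {P \<in> spec_points E. \<not> S \<subseteq> P}" by blast
next
  fix \<U> :: "'a set set set"
  assume "\<forall>U\<in>\<U>. \<exists>S. U = {P \<in> spec_points E. \<not> S \<subseteq> P}"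
  then obtain S where "\<And>U. U \<in> \<U> \<Longrightarrow> U = {P \<in> spec_points E. \<not> S U \<subseteq> P}"
    by metis
  hence "\<Union>\<U> = {P \<in> spec_points E. \<not> (\<Union>U\<in>\<U>. S U) \<subseteq> P}"
    by blast
  thus "\<exists>S. \<Union>\<U> = {P \<in> spec_points E. \<not> S \<subseteq> P}" by blast
qed

lemma openin_spec_mod:
  "openin (spec_mod E) U \<longleftrightarrow> (\<exists>S. U = {P \<in> spec_points E. \<not> S \<subseteq> P})"
  by (simp add: spec_mod_def topology_inverse'[OF istopology_spec_mod])

lemma topspace_spec_mod: "topspace (spec_mod E) = spec_points E"
proof -
  have "spec_points E = {P \<in> spec_points E. \<not> {1} \<subseteq> P}"
    by (auto simp: spec_points_def prime_ideal_def)
  hence "openin (spec_mod E) (spec_points E)"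
    unfolding openin_spec_mod by blast
  moreover have "U \<subseteq> spec_points E" if "openin (spec_mod E) U" for U
    using that unfolding openin_spec_mod by blast
  ultimately show ?thesis
    by (metis openin_subset openin_topspace subset_antisym)
qed

definition arc_space :: "(complex ^ 'n \<Rightarrow> complex) \<Rightarrow> 'n arc_var cpoly set topology" where
  "arc_space f = spec_mod (range (fps_nth (arc_equation f)))"

text \<open>A formal arc is a \<open>\<complex>\<close>-point of the arc scheme; it is identified with the kernel of the
  corresponding evaluation homomorphism.\<close>

fun arc_coord :: "'n::finite arc \<Rightarrow> 'n arc_var \<Rightarrow> complex" where
  "arc_coord a (Psi1 k) = fps_nth (fst a) (Suc k)"
| "arc_coord a (Psi2 k) = fps_nth (fst (snd a)) (Suc k)"
| "arc_coord a (Phi i k) = fps_nth (snd (snd a) $ i) (Suc k)"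

definition arc_point :: "'n::finite arc \<Rightarrow> 'n arc_var cpoly set" where
  "arc_point a = {p. cpoly_eval (arc_coord a) p = 0}"


section \<open>Irreducible components\<close>

definition irreducible_in :: "'a topology \<Rightarrow> 'a set \<Rightarrow> bool" where
  "irreducible_in T S \<longleftrightarrow> S \<subseteq> topspace T \<and> S \<noteq> {} \<and>
     (\<forall>C D. closedin T C \<and> closedin T D \<and> S \<subseteq> C \<union> D \<longrightarrow> S \<subseteq> C \<or> S \<subseteq> D)"

definition irreducible_components :: "'a topology \<Rightarrow> 'a set set" where
  "irreducible_components T =
     {S. irreducible_in T S \<and> (\<forall>S'. irreducible_in T S' \<and> S \<subseteq> S' \<longrightarrow> S' = S)}"

end

theory Submission
  imports
    Defs
    "HOL-Computational_Algebra.Fundamental_Theorem_Algebra"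
    "HOL-Computational_Algebra.Polynomial_FPS"
begin

text \<open>
  Write \<open>F\<close> for the Taylor series of \<open>f\<close>. The point of the proof is that everything can be
  seen on complex points, that is on honest arcs \<open>(\<psi>\<^sub>1, \<psi>\<^sub>2, \<phi>)\<close>, and that limits of arcs
  may be taken in the classical sense, coefficient by coefficient.

  Since \<open>\<phi>\<close> has no constant term, \<open>F(\<phi>)\<close> has order at least \<open>m\<close>; hence the orders of
  \<open>\<psi>\<^sub>1\<close> and \<open>\<psi>\<^sub>2\<close> add up to at least \<open>m\<close>, and for some \<open>0 < i < m\<close> they are at least \<open>i\<close>
  and \<open>m - i\<close>. Let the \<open>i\<close>-th stratum consist of the arcs for which these orders are exactly
  \<open>i\<close> and \<open>m - i\<close>, and let \<open>Q\<^sub>i\<close> be the ideal of polynomials in the coefficients that vanish on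
  it. The components are the loci \<open>V(Q\<^sub>i)\<close>. Four facts carry this.

  \<^item> \<open>Q\<^sub>i\<close> is prime (\<open>stratum_irreducible\<close>). Writing \<open>\<psi>\<^sub>1 = t\<^sup>i u\<close>, an arc of the stratum is
    determined by \<open>u\<close> and \<open>\<phi>\<close>, because \<open>\<psi>\<^sub>2 = F(\<phi>) / \<psi>\<^sub>1\<close>. Joining the parameters \<open>(u, \<phi>)\<close> of
    two arcs by a line gives arcs whose coefficients are rational functions of one complex
    parameter, and finitely many nonzero rational functions are nonzero simultaneously somewhere.

  \<^item> Every arc with orders at least \<open>i\<close> and \<open>m - i\<close> is a limit of arcs of the \<open>i\<close>-th stratum
    (\<open>stratum_dense\<close>). Put \<open>\<psi>\<^sub>1 = t\<^sup>i u\<close> and \<open>\<psi>\<^sub>2 = t\<^sup>m\<^sup>-\<^sup>i v\<close>, so that \<open>u v = t\<^sup>-\<^sup>m F(\<phi>)\<close>. Moving the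
    linear coefficients of \<open>\<phi>\<close> slightly makes the constant term of \<open>t\<^sup>-\<^sup>m F(\<phi>)\<close> nonzero, as it
    is the leading form of \<open>F\<close> at these coefficients. It remains to move \<open>u\<close> and \<open>v\<close> along with
    their product. Only finitely many coefficients matter, so \<open>u\<close> and \<open>v\<close> may be replaced by
    monic polynomials that agree with them to high order; and multiplication of monic complex
    polynomials is an open map, because roots depend continuously on the coefficients
    (\<open>monic_factors_deform\<close>). This treats all cases, even \<open>u = 0\<close> or \<open>v = 0\<close>, at once.

  \<^item> A point of the arc scheme, i.e. a prime ideal \<open>P\<close> containing the equations, contains some
    \<open>Q\<^sub>i\<close> (\<open>arc_space_point_in_some_stratum_closure\<close>). Otherwise choose \<open>h\<^sub>i \<in> Q\<^sub>i\<close> outside \<open>P\<close>. The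
    product of the \<open>h\<^sub>i\<close> vanishes at all arcs by the previous fact, but is not in \<open>P\<close>; this
    contradicts the Nullstellensatz. The ring has infinitely many variables, but only countably
    many, and over the uncountable field \<open>\<complex>\<close> this suffices (\<open>nullstellensatz_countable\<close>).

  \<^item> The \<open>Q\<^sub>i\<close> are pairwise incomparable: the coefficient of \<open>t\<^sup>i\<close> in \<open>\<psi>\<^sub>1\<close> and that of \<open>t\<^sup>m\<^sup>-\<^sup>i\<close> in
    \<open>\<psi>\<^sub>2\<close> lie outside \<open>Q\<^sub>i\<close>, while all lower ones lie in it. The product of these two coefficients
    cuts out the dense open subset of \<open>V(Q\<^sub>i)\<close>.
\<close>

section \<open>Evaluation of polynomials in arbitrarily many variables\<close>

lemma poly_mapping_eq_sum_single:
  fixes p :: "'a \<Rightarrow>\<^sub>0 'b::comm_monoid_add"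
  shows "p = (\<Sum>\<mu>\<in>Poly_Mapping.keys p. Poly_Mapping.single \<mu> (Poly_Mapping.lookup p \<mu>))"
proof (rule poly_mapping_eqI)
  fix \<nu>
  have "Poly_Mapping.lookup (\<Sum>\<mu>\<in>Poly_Mapping.keys p. Poly_Mapping.single \<mu> (Poly_Mapping.lookup p \<mu>)) \<nu>
      = (\<Sum>\<mu>\<in>Poly_Mapping.keys p. if \<mu> = \<nu> then Poly_Mapping.lookup p \<mu> else 0)"
    by (simp add: lookup_sum lookup_single when_def)
  also have "\<dots> = Poly_Mapping.lookup p \<nu>"
    by (simp add: in_keys_iff)
  finally show "Poly_Mapping.lookup p \<nu> =
      Poly_Mapping.lookup (\<Sum>\<mu>\<in>Poly_Mapping.keys p. Poly_Mapping.single \<mu> (Poly_Mapping.lookup p \<mu>)) \<nu>"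
    by simp
qed

text \<open>Statements about all polynomials reduce to constants and variables. This replaces every later
  calculation with monomials.\<close>

lemma cpoly_induct [case_names const var add mult]:
  fixes p :: "'v cpoly"
  assumes const: "\<And>a. P (cpoly_const a)" and var: "\<And>v. P (cpoly_var v)"
    and add: "\<And>p q. P p \<Longrightarrow> P q \<Longrightarrow> P (p + q)" and mult: "\<And>p q. P p \<Longrightarrow> P q \<Longrightarrow> P (p * q)"
  shows "P p"
proof -
  have one: "P 1"
    using const[of 1] by (simp add: cpoly_const_def)
  have zero: "P 0"
    using const[of 0] by (simp add: cpoly_const_def)
  have power: "P (Poly_Mapping.single (Poly_Mapping.single v k) 1)" for v k
  proof (induction k)
    case (Suc k)
    have "Poly_Mapping.single (Poly_Mapping.single v (Suc k)) 1 =
        cpoly_var v * Poly_Mapping.single (Poly_Mapping.single v k) 1"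
      by (simp add: cpoly_var_def mult_single single_add[symmetric])
    then show ?case using Suc var mult by simp
  qed (use one in simp)
  have "P (Poly_Mapping.single (\<Sum>v\<in>A. Poly_Mapping.single v (k v)) 1)" if "finite A" for A k
    using that
  proof induction
    case (insert v A)
    have "Poly_Mapping.single (\<Sum>v\<in>insert v A. Poly_Mapping.single v (k v)) (1::complex) =
        Poly_Mapping.single (Poly_Mapping.single v (k v)) 1 *
        Poly_Mapping.single (\<Sum>v\<in>A. Poly_Mapping.single v (k v)) 1"
      using insert by (simp add: mult_single)
    then show ?case using insert.IH power mult by simp
  qed (use one in simp)
  then have monomial: "P (Poly_Mapping.single \<mu> 1)" for \<mu>
    by (subst poly_mapping_eq_sum_single[of \<mu>]) simp
  have single: "P (Poly_Mapping.single \<mu> a)" for \<mu> a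
    using mult[OF const[of a] monomial[of \<mu>]] by (simp add: cpoly_const_def mult_single)
  have "P (\<Sum>\<mu>\<in>A. Poly_Mapping.single \<mu> (Poly_Mapping.lookup p \<mu>))" if "finite A" for A
    using that
  proof induction
    case (insert \<mu> A)
    then show ?case
      using add[OF single[of \<mu> "Poly_Mapping.lookup p \<mu>"]] by simp
  qed (use zero in simp)
  from this[OF finite_keys] show ?thesis
    by (subst poly_mapping_eq_sum_single[of p])
qed

definition monomial_eval :: "('v \<Rightarrow> complex) \<Rightarrow> ('v \<Rightarrow>\<^sub>0 nat) \<Rightarrow> complex" where
  "monomial_eval \<sigma> \<mu> = (\<Prod>v\<in>Poly_Mapping.keys \<mu>. \<sigma> v ^ Poly_Mapping.lookup \<mu> v)"

lemma monomial_eval_add: "monomial_eval \<sigma> (\<mu> + \<nu>) = monomial_eval \<sigma> \<mu> * monomial_eval \<sigma> \<nu>"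
proof -
  have *: "monomial_eval \<sigma> \<kappa> = (\<Prod>v\<in>S. \<sigma> v ^ Poly_Mapping.lookup \<kappa> v)"
    if "finite S" "Poly_Mapping.keys \<kappa> \<subseteq> S" for \<kappa> S
    unfolding monomial_eval_def using that
    by (intro prod.mono_neutral_left) (auto simp: in_keys_iff)
  let ?S = "Poly_Mapping.keys \<mu> \<union> Poly_Mapping.keys \<nu>"
  show ?thesis
    using *[of ?S \<mu>] *[of ?S \<nu>] *[of ?S "\<mu> + \<nu>"] Poly_Mapping.keys_add[of \<mu> \<nu>]
    by (simp add: lookup_add power_add prod.distrib)
qed

lemma cpoly_eval_monomials:
  assumes "finite S" "Poly_Mapping.keys p \<subseteq> S"
  shows "cpoly_eval \<sigma> p = (\<Sum>\<mu>\<in>S. Poly_Mapping.lookup p \<mu> * monomial_eval \<sigma> \<mu>)"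
  unfolding cpoly_eval_def monomial_eval_def[symmetric] using assms
  by (intro sum.mono_neutral_left) (auto simp: in_keys_iff)

lemma cpoly_eval_single: "cpoly_eval \<sigma> (Poly_Mapping.single \<mu> a) = a * monomial_eval \<sigma> \<mu>"
  by (subst cpoly_eval_monomials[of "{\<mu>}"]) (auto simp: split: if_splits)

lemma cpoly_eval_const [simp]: "cpoly_eval \<sigma> (cpoly_const a) = a"
  by (simp add: cpoly_const_def cpoly_eval_single monomial_eval_def)

lemma cpoly_eval_0 [simp]: "cpoly_eval \<sigma> 0 = 0"
  by (simp add: cpoly_eval_def)

lemma cpoly_eval_1 [simp]: "cpoly_eval \<sigma> 1 = 1"
  using cpoly_eval_const[of \<sigma> 1] by (simp add: cpoly_const_def)

lemma cpoly_eval_var [simp]: "cpoly_eval \<sigma> (cpoly_var v) = \<sigma> v"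
  by (simp add: cpoly_var_def cpoly_eval_single monomial_eval_def)

lemma cpoly_eval_add [simp]: "cpoly_eval \<sigma> (p + q) = cpoly_eval \<sigma> p + cpoly_eval \<sigma> q"
  using Poly_Mapping.keys_add[of p q]
  by (simp add: cpoly_eval_monomials[of "Poly_Mapping.keys p \<union> Poly_Mapping.keys q"]
      lookup_add distrib_right sum.distrib)

lemma cpoly_eval_sum [simp]: "cpoly_eval \<sigma> (\<Sum>x\<in>A. p x) = (\<Sum>x\<in>A. cpoly_eval \<sigma> (p x))"
  by (induction A rule: infinite_finite_induct) auto

lemma cpoly_eval_mult [simp]: "cpoly_eval \<sigma> (p * q) = cpoly_eval \<sigma> p * cpoly_eval \<sigma> q"
proof -
  let ?s = "\<lambda>p \<mu>. Poly_Mapping.single \<mu> (Poly_Mapping.lookup p \<mu>)"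
  have "cpoly_eval \<sigma> (p * q) =
      cpoly_eval \<sigma> ((\<Sum>\<mu>\<in>Poly_Mapping.keys p. ?s p \<mu>) * (\<Sum>\<nu>\<in>Poly_Mapping.keys q. ?s q \<nu>))"
    by (simp flip: poly_mapping_eq_sum_single)
  also have "\<dots> = (\<Sum>\<mu>\<in>Poly_Mapping.keys p. \<Sum>\<nu>\<in>Poly_Mapping.keys q.
      cpoly_eval \<sigma> (?s p \<mu>) * cpoly_eval \<sigma> (?s q \<nu>))"
    by (simp add: sum_product mult_single cpoly_eval_single monomial_eval_add mult_ac)
  also have "\<dots> = cpoly_eval \<sigma> p * cpoly_eval \<sigma> q"
    by (simp only: sum_product[symmetric] cpoly_eval_single
        cpoly_eval_monomials[of "Poly_Mapping.keys p" p, OF finite_keys order_refl]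
        cpoly_eval_monomials[of "Poly_Mapping.keys q" q, OF finite_keys order_refl])
  finally show ?thesis .
qed

lemma cpoly_eval_minus [simp]: "cpoly_eval \<sigma> (- p) = - cpoly_eval \<sigma> p"
  using cpoly_eval_add[of \<sigma> p "- p"] by (simp add: eq_neg_iff_add_eq_0 add.commute)

lemma cpoly_eval_diff [simp]: "cpoly_eval \<sigma> (p - q) = cpoly_eval \<sigma> p - cpoly_eval \<sigma> q"
  using cpoly_eval_add[of \<sigma> p "- q"] by simp

lemma cpoly_eval_prod [simp]: "cpoly_eval \<sigma> (\<Prod>x\<in>A. p x) = (\<Prod>x\<in>A. cpoly_eval \<sigma> (p x))"
  by (induction A rule: infinite_finite_induct) auto

lemma cpoly_const_simps:
  "cpoly_const 0 = 0" "cpoly_const 1 = 1"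
  "cpoly_const (a + b) = cpoly_const a + cpoly_const b"
  "cpoly_const (a - b) = cpoly_const a - cpoly_const b"
  "cpoly_const (- a) = - cpoly_const a"
  "cpoly_const (a * b) = cpoly_const a * cpoly_const b"
  by (simp_all add: cpoly_const_def single_add single_diff single_uminus mult_single)

section \<open>A Nullstellensatz for countably many variables\<close>

text \<open>A homogeneous linear system with more unknowns \<open>c a\<close> than equations has a nontrivial
  solution, by elimination of one unknown at a time. Below, it yields linear relations between
  polynomials whose monomials come from a fixed finite set.\<close>

lemma homogeneous_system_nontrivial:
  fixes B :: "'a \<Rightarrow> 'b \<Rightarrow> 'c::field"
  assumes "finite M" "finite T" "card T > card M"
  shows "\<exists>c. (\<exists>a\<in>T. c a \<noteq> 0) \<and> (\<forall>\<mu>\<in>M. (\<Sum>a\<in>T. c a * B a \<mu>) = 0)"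
  using assms
proof (induction M arbitrary: T B)
  case empty
  then show ?case by (intro exI[of _ "\<lambda>_. 1"]) (auto simp: card_gt_0_iff)
next
  case (insert \<nu> M)
  show ?case
  proof (cases "\<forall>a\<in>T. B a \<nu> = 0")
    case True
    then show ?thesis using insert.IH[of T B] insert.prems insert.hyps by auto
  next
    case False
    then obtain b where b: "b \<in> T" "B b \<nu> \<noteq> 0" by blast
    \<comment> \<open>\<open>c b\<close> is eliminated by means of the equation \<open>\<nu>\<close>.\<close>
    define B' where "B' = (\<lambda>a \<mu>. B a \<mu> - B a \<nu> / B b \<nu> * B b \<mu>)"
    have "card (T - {b}) > card M"
      using insert.prems insert.hyps b by simp
    then obtain c where c: "\<exists>a\<in>T - {b}. c a \<noteq> 0"
      and sol: "\<forall>\<mu>\<in>M. (\<Sum>a\<in>T - {b}. c a * B' a \<mu>) = 0"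
      using insert.IH[of "T - {b}" B'] insert.prems by auto
    define c' where "c' = c(b := - (\<Sum>a\<in>T - {b}. c a * B a \<nu>) / B b \<nu>)"
    have split: "(\<Sum>a\<in>T. c' a * B a \<mu>) = (\<Sum>a\<in>T - {b}. c a * B' a \<mu>)" for \<mu>
    proof -
      have "(\<Sum>a\<in>T. c' a * B a \<mu>) = c' b * B b \<mu> + (\<Sum>a\<in>T - {b}. c' a * B a \<mu>)"
        using insert.prems b by (intro sum.remove)
      also have "(\<Sum>a\<in>T - {b}. c' a * B a \<mu>) = (\<Sum>a\<in>T - {b}. c a * B a \<mu>)"
        by (simp add: c'_def)
      finally show ?thesis
        using b(2) by (simp add: c'_def B'_def right_diff_distrib sum_subtractf sum_distrib_left
            sum_distrib_right[symmetric] sum_divide_distrib[symmetric])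
          (simp add: sum_distrib_left sum_divide_distrib mult_ac)
    qed
    have "(\<Sum>a\<in>T. c' a * B a \<mu>) = 0" if "\<mu> \<in> insert \<nu> M" for \<mu>
      using that sol b unfolding split by (auto simp: B'_def)
    then show ?thesis using c by (intro exI[of _ c']) (auto simp: c'_def)
  qed
qed

definition is_ideal :: "'a::comm_ring_1 set \<Rightarrow> bool" where
  "is_ideal I \<longleftrightarrow> 0 \<in> I \<and> (\<forall>a\<in>I. \<forall>b\<in>I. a + b \<in> I) \<and> (\<forall>a. \<forall>b\<in>I. a * b \<in> I)"

lemma prime_idealD:
  assumes "prime_ideal P"
  shows "0 \<in> P" "a \<in> P \<Longrightarrow> b \<in> P \<Longrightarrow> a + b \<in> P" "b \<in> P \<Longrightarrow> a * b \<in> P" "a \<in> P \<Longrightarrow> a * b \<in> P"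
    "1 \<notin> P" "a * b \<in> P \<Longrightarrow> a \<in> P \<or> b \<in> P" "a \<in> P \<Longrightarrow> b \<in> P \<Longrightarrow> a - b \<in> P"
proof -
  show absorb: "a * b \<in> P" if "b \<in> P" for a b
    using assms that by (simp add: prime_ideal_def)
  then show "a * b \<in> P" if "a \<in> P" for a b
    using that by (simp add: mult.commute)
  show "a - b \<in> P" if "a \<in> P" "b \<in> P" for a b
    using assms that absorb[of b "-1"] unfolding prime_ideal_def by (metis diff_conv_add_uminus mult_minus1)
qed (use assms in \<open>auto simp: prime_ideal_def\<close>)

lemma prime_ideal_sum_mem: "prime_ideal P \<Longrightarrow> (\<And>x. x \<in> A \<Longrightarrow> f x \<in> P) \<Longrightarrow> sum f A \<in> P"
  by (induction A rule: infinite_finite_induct) (auto intro: prime_idealD)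

lemma prime_ideal_prod_mem:
  assumes "prime_ideal P" "finite A" "prod f A \<in> P"
  obtains x where "x \<in> A" "f x \<in> P"
proof -
  have "\<exists>x\<in>A. f x \<in> P"
    using assms(2,3)
  proof induction
    case empty
    then show ?case using prime_idealD(5)[OF assms(1)] by simp
  next
    case (insert x F)
    then show ?case using prime_idealD(6)[OF assms(1), of "f x" "prod f F"] by auto
  qed
  then show ?thesis using that by blast
qed

lemma prime_ideal_power_mem: "prime_ideal P \<Longrightarrow> a ^ k \<in> P \<Longrightarrow> a \<in> P"
  by (induction k) (auto dest: prime_idealD)

text \<open>By Zorn's lemma, \<open>P\<close> lies in an ideal \<open>M\<close> that is maximal among those without a power of \<open>h\<close>.
  Such an ideal is prime, and it is a maximal ideal after inverting \<open>h\<close>: an element outside \<open>M\<close>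
  divides a power of \<open>h\<close> modulo \<open>M\<close>.\<close>

lemma prime_ideal_avoiding_powers:
  fixes P :: "'a::comm_ring_1 set"
  assumes P: "prime_ideal P" "h \<notin> P"
  obtains M where "prime_ideal M" "P \<subseteq> M" "h \<notin> M"
    "\<And>y. y \<notin> M \<Longrightarrow> \<exists>k b. h ^ k - b * y \<in> M"
proof -
  define \<I> where "\<I> = {I. is_ideal I \<and> P \<subseteq> I \<and> (\<forall>k. h ^ k \<notin> I)}"
  have "P \<in> \<I>"
    using P prime_ideal_power_mem[OF P(1)] by (auto simp: \<I>_def is_ideal_def prime_ideal_def)
  moreover have "\<Union>\<C> \<in> \<I>" if "\<C> \<noteq> {}" "subset.chain \<I> \<C>" for \<C>
  proof -
    have \<C>: "I \<in> \<C> \<Longrightarrow> is_ideal I \<and> P \<subseteq> I \<and> (\<forall>k. h ^ k \<notin> I)" for I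
      using that by (auto simp: subset.chain_def \<I>_def)
    have "a + b \<in> \<Union>\<C>" if ab: "a \<in> \<Union>\<C>" "b \<in> \<Union>\<C>" for a b
    proof -
      obtain I J where IJ: "I \<in> \<C>" "J \<in> \<C>" "a \<in> I" "b \<in> J" using ab by blast
      then have "I \<subseteq> J \<or> J \<subseteq> I"
        using \<open>subset.chain \<I> \<C>\<close> by (auto simp: subset.chain_def)
      then obtain K where "K \<in> \<C>" "a \<in> K" "b \<in> K" using IJ by blast
      then show ?thesis using \<C>[of K] unfolding is_ideal_def by blast
    qed
    moreover have "a * b \<in> \<Union>\<C>" if "b \<in> \<Union>\<C>" for a b
      using that \<C> unfolding is_ideal_def by blast
    moreover have "0 \<in> \<Union>\<C>" "P \<subseteq> \<Union>\<C>" "\<forall>k. h ^ k \<notin> \<Union>\<C>"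
      using \<open>\<C> \<noteq> {}\<close> \<C> unfolding is_ideal_def by blast+
    ultimately show ?thesis unfolding \<I>_def is_ideal_def by blast
  qed
  ultimately obtain M where M: "M \<in> \<I>" and maximal: "\<And>I. I \<in> \<I> \<Longrightarrow> M \<subseteq> I \<Longrightarrow> I = M"
    using subset_Zorn_nonempty[of \<I>] by blast
  have ideal: "0 \<in> M" "\<And>a b. a \<in> M \<Longrightarrow> b \<in> M \<Longrightarrow> a + b \<in> M" "\<And>a b. b \<in> M \<Longrightarrow> a * b \<in> M"
    and avoid: "\<And>k. h ^ k \<notin> M" and "P \<subseteq> M"
    using M by (auto simp: \<I>_def is_ideal_def)
  have power: "\<exists>k b. h ^ k - b * y \<in> M" if "y \<notin> M" for y
  proof -
    define I where "I = {m + b * y | m b. m \<in> M}"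
    have "is_ideal I"
      unfolding is_ideal_def
    proof (intro conjI ballI allI)
      show "0 \<in> I" unfolding I_def using ideal(1) by (auto intro!: exI[of _ 0])
    next
      fix a b assume "a \<in> I" "b \<in> I"
      then obtain m c m' c' where "a = m + c * y" "b = m' + c' * y" "m \<in> M" "m' \<in> M"
        unfolding I_def by blast
      then show "a + b \<in> I" unfolding I_def
        by (intro CollectI exI[of _ "m + m'"] exI[of _ "c + c'"]) (auto simp: ideal algebra_simps)
    next
      fix a b assume "b \<in> I"
      then obtain m c where "b = m + c * y" "m \<in> M"
        unfolding I_def by blast
      then show "a * b \<in> I" unfolding I_def
        by (intro CollectI exI[of _ "a * m"] exI[of _ "a * c"]) (auto simp: ideal algebra_simps)
    qed
    moreover have "M \<subseteq> I"
    proof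
      fix m assume "m \<in> M"
      then show "m \<in> I" unfolding I_def by (intro CollectI exI[of _ m] exI[of _ 0]) auto
    qed
    moreover have "y \<in> I"
      unfolding I_def using ideal(1) by (intro CollectI exI[of _ 0] exI[of _ 1]) auto
    ultimately have "\<not> (\<forall>k. h ^ k \<notin> I)"
      using maximal[of I] \<open>P \<subseteq> M\<close> that unfolding \<I>_def by blast
    then obtain k m b where "h ^ k = m + b * y" "m \<in> M" unfolding I_def by blast
    then show ?thesis by (intro exI[of _ k] exI[of _ b]) simp
  qed
  have "prime_ideal M"
    unfolding prime_ideal_def
  proof (intro conjI ballI allI impI)
    show "1 \<notin> M" using avoid[of 0] by simp
  next
    fix a b assume ab: "a * b \<in> M"
    show "a \<in> M \<or> b \<in> M"
    proof (rule ccontr)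
      assume "\<not> (a \<in> M \<or> b \<in> M)"
      then obtain k c l d where kc: "h ^ k - c * a \<in> M" and ld: "h ^ l - d * b \<in> M"
        using power by meson
      have "h ^ (k + l) = h ^ l * (h ^ k - c * a) + ((c * a) * (h ^ l - d * b) + c * d * (a * b))"
        by (simp add: power_add algebra_simps)
      also have "\<dots> \<in> M"
        by (rule ideal(2)[OF ideal(3)[OF kc] ideal(2)[OF ideal(3)[OF ld] ideal(3)[OF ab]]])
      finally show False using avoid by blast
    qed
  qed (use ideal in auto)
  then show ?thesis
    using that[of M] \<open>P \<subseteq> M\<close> avoid[of 1] power by auto
qed

text \<open>A monomial is determined by the finite graph of its exponents on its support.\<close>

lemma countable_monomials:
  assumes "countable (UNIV :: 'v set)"
  shows "countable (UNIV :: ('v \<Rightarrow>\<^sub>0 nat) set)"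
proof -
  let ?graph = "\<lambda>\<mu> :: 'v \<Rightarrow>\<^sub>0 nat. (\<lambda>v. (v, Poly_Mapping.lookup \<mu> v)) ` Poly_Mapping.keys \<mu>"
  have "inj ?graph"
  proof (rule injI)
    fix \<mu> \<nu> :: "'v \<Rightarrow>\<^sub>0 nat"
    assume eq: "?graph \<mu> = ?graph \<nu>"
    have "Poly_Mapping.lookup \<mu> v = n \<longleftrightarrow> (v, n) \<in> ?graph \<mu> \<or> (n = 0 \<and> v \<notin> fst ` ?graph \<mu>)" for \<mu> v n
      by (force simp: in_keys_iff image_iff)
    then show "\<mu> = \<nu>"
      using eq by (metis poly_mapping_eqI)
  qed
  moreover have "countable (?graph ` UNIV)"
  proof (rule countable_subset)
    show "?graph ` UNIV \<subseteq> {A. finite A \<and> A \<subseteq> UNIV}" by auto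
    show "countable {A :: ('v \<times> nat) set. finite A \<and> A \<subseteq> UNIV}"
      using assms by (intro countable_Collect_finite_subset)
        (metis UNIV_Times_UNIV countable_SIGMA countableI_type)
  qed
  ultimately show ?thesis
    by (rule countable_image_inj_on[rotated])
qed

abbreviation at_cpoly :: "complex poly \<Rightarrow> 'v cpoly \<Rightarrow> 'v cpoly" where
  "at_cpoly r x \<equiv> poly (map_poly cpoly_const r) x"

lemma at_cpoly_pCons: "at_cpoly (pCons a r) x = cpoly_const a + x * at_cpoly r x"
  by (simp add: map_poly_pCons cpoly_const_simps)

lemma at_cpoly_add: "at_cpoly (p + q) x = at_cpoly p x + at_cpoly q x"
  by (induction p q rule: poly_induct2) (simp_all add: at_cpoly_pCons cpoly_const_simps algebra_simps)

lemma at_cpoly_sum: "at_cpoly (\<Sum>a\<in>A. p a) x = (\<Sum>a\<in>A. at_cpoly (p a) x)"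
  by (induction A rule: infinite_finite_induct) (simp_all add: at_cpoly_add)

lemma at_cpoly_smult: "at_cpoly (smult c p) x = cpoly_const c * at_cpoly p x"
  by (simp add: map_poly_smult cpoly_const_simps)

lemma at_cpoly_linear: "at_cpoly ([:- a, 1:] * p) x = (x - cpoly_const a) * at_cpoly p x"
proof -
  have "[:- a, 1:] * p = pCons 0 p + smult (- a) p" by simp
  then show ?thesis
    by (simp only: at_cpoly_add at_cpoly_smult at_cpoly_pCons cpoly_const_simps) (simp add: algebra_simps)
qed

lemma at_cpoly_prod_linear: "at_cpoly (\<Prod>a\<in>A. [:- f a, 1:]) x = (\<Prod>a\<in>A. x - cpoly_const (f a))"
  by (induction A rule: infinite_finite_induct)
    (simp_all add: at_cpoly_linear map_poly_1' cpoly_const_simps del: mult_pCons_left)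

lemma prime_ideal_const_mem: "prime_ideal (M :: 'v cpoly set) \<Longrightarrow> cpoly_const a \<in> M \<Longrightarrow> a = 0"
  using prime_idealD(3)[of M "cpoly_const a" "cpoly_const (inverse a)"] prime_idealD(5)[of M]
  by (cases "a = 0") (auto simp: cpoly_const_simps[symmetric])

text \<open>Over the algebraically closed field \<open>\<complex>\<close>, \<open>r\<close> splits into linear factors, one of which a prime
  ideal must contain.\<close>

lemma root_modulo_prime:
  fixes M :: "'v cpoly set"
  assumes "prime_ideal M" "r \<noteq> 0" "at_cpoly r x \<in> M"
  obtains \<rho> where "x - cpoly_const \<rho> \<in> M"
proof -
  have "\<exists>\<rho>. x - cpoly_const \<rho> \<in> M"
    using assms(2,3)
  proof (induction "degree r" arbitrary: r)
    case 0
    then obtain a where "r = [:a:]" by (metis degree_eq_zeroE)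
    then show ?case
      using 0 prime_ideal_const_mem[OF assms(1)] by (auto simp: at_cpoly_pCons)
  next
    case (Suc n)
    then obtain z where "poly r z = 0"
      using fundamental_theorem_of_algebra[of r] constant_degree[of r] by auto
    then obtain q where q: "r = [:- z, 1:] * q"
      by (metis dvd_def poly_eq_0_iff_dvd)
    then have "n = degree q" "q \<noteq> 0"
      using Suc by (auto simp: degree_mult_eq simp del: mult_pCons_left)
    then show ?case
      using Suc prime_idealD(6)[OF assms(1)] unfolding q at_cpoly_linear by blast
  qed
  then show ?thesis using that by blast
qed

text \<open>This is where uncountability of the ground field replaces finiteness of the number of
  variables. If no \<open>x - a\<close> were in \<open>M\<close>, there would be \<open>b\<^sub>a\<close> with \<open>h\<^sup>k = b\<^sub>a (x - a)\<close> modulo \<open>M\<close>,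
  the exponent \<open>k\<close> depending on \<open>a\<close>. The exponents and the sets of monomials of the \<open>b\<^sub>a\<close> are
  countable in number, so infinitely many \<open>a\<close> share both, and the corresponding \<open>b\<^sub>a\<close> satisfy a
  linear relation. Clearing the denominators \<open>x - a\<close> in it gives a nonzero polynomial \<open>r\<close> in one
  variable with \<open>h\<^sup>k r(x) \<in> M\<close>, hence a root of \<open>r\<close> that is a value of \<open>x\<close> modulo \<open>M\<close>.\<close>

lemma value_modulo_maximal:
  fixes M :: "'v cpoly set"
  assumes countable: "countable (UNIV :: 'v set)"
    and M: "prime_ideal M" "h \<notin> M" "\<And>y. y \<notin> M \<Longrightarrow> \<exists>k b. h ^ k - b * y \<in> M"
  obtains \<rho> where "x - cpoly_const \<rho> \<in> M"
proof (rule ccontr)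
  assume none: "\<not> thesis"
  \<comment> \<open>Real values of \<open>a\<close> suffice, as there are uncountably many.\<close>
  let ?x = "\<lambda>a :: real. x - cpoly_const (of_real a)"
  have "?x a \<notin> M" for a
    using none that by blast
  then have "\<forall>a. \<exists>k b. h ^ k - b * ?x a \<in> M"
    using M(3) by blast
  then obtain k where "\<forall>a. \<exists>b. h ^ k a - b * ?x a \<in> M"
    by (rule choice[THEN exE])
  then obtain b where "\<forall>a. h ^ k a - b a * ?x a \<in> M"
    by (rule choice[THEN exE])
  then have kb: "h ^ k a - b a * ?x a \<in> M" for a
    by blast
  let ?type = "\<lambda>a. (k a, Poly_Mapping.keys (b a))"
  have "\<exists>a. infinite {a'. ?type a' = ?type a}"
  proof (rule ccontr)
    assume "\<not> (\<exists>a. infinite {a'. ?type a' = ?type a})"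
    then have "countable (\<Union>y\<in>range ?type. {a. ?type a = y})"
    proof (intro countable_UN)
      have "countable ((UNIV :: nat set) \<times> {S :: ('v \<Rightarrow>\<^sub>0 nat) set. finite S \<and> S \<subseteq> UNIV})"
        using countable_Collect_finite_subset[OF countable_monomials[OF countable]]
        by (rule countable_SIGMA[OF countableI_type])
      then show "countable (range ?type)"
        by (rule countable_subset[rotated]) auto
    next
      fix y assume "y \<in> range ?type"
      then obtain a where "y = ?type a" by blast
      then show "countable {a. ?type a = y}"
        using \<open>\<not> (\<exists>a. infinite {a'. ?type a' = ?type a})\<close> by (simp add: countable_finite)
    qed
    moreover have "(\<Union>y\<in>range ?type. {a. ?type a = y}) = UNIV" by blast
    ultimately show False using uncountable_UNIV_real by simp
  qed
  then obtain a\<^sub>0 where a\<^sub>0: "infinite {a. ?type a = ?type a\<^sub>0}" by blast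
  obtain T where T: "finite T" "card T = Suc (card (Poly_Mapping.keys (b a\<^sub>0)))"
    "T \<subseteq> {a. ?type a = ?type a\<^sub>0}"
    using infinite_arbitrarily_large[OF a\<^sub>0, of "Suc (card (Poly_Mapping.keys (b a\<^sub>0)))"]
    by (elim exE conjE)
  have "\<exists>c. (\<exists>a\<in>T. c a \<noteq> 0) \<and>
      (\<forall>\<mu>\<in>Poly_Mapping.keys (b a\<^sub>0). (\<Sum>a\<in>T. c a * Poly_Mapping.lookup (b a) \<mu>) = 0)"
    by (rule homogeneous_system_nontrivial) (simp_all add: T(1,2))
  then obtain c where c: "\<exists>a\<in>T. c a \<noteq> 0"
    and rel: "\<And>\<mu>. \<mu> \<in> Poly_Mapping.keys (b a\<^sub>0) \<Longrightarrow> (\<Sum>a\<in>T. c a * Poly_Mapping.lookup (b a) \<mu>) = 0"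
    by blast
  have dependent: "(\<Sum>a\<in>T. cpoly_const (c a) * b a) = 0"
  proof (rule poly_mapping_eqI)
    fix \<mu>
    have "Poly_Mapping.lookup (cpoly_const (c a) * b a) \<mu> = c a * Poly_Mapping.lookup (b a) \<mu>" for a
      unfolding cpoly_const_def mult_map_scale_conv_mult[symmetric]
      by (simp add: Poly_Mapping.map.rep_eq when_def)
    then have "Poly_Mapping.lookup (\<Sum>a\<in>T. cpoly_const (c a) * b a) \<mu> =
        (\<Sum>a\<in>T. c a * Poly_Mapping.lookup (b a) \<mu>)"
      by (simp add: lookup_sum)
    also have "\<dots> = 0"
    proof (cases "\<mu> \<in> Poly_Mapping.keys (b a\<^sub>0)")
      case False
      then have "Poly_Mapping.lookup (b a) \<mu> = 0" if "a \<in> T" for a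
        using subsetD[OF T(3) that] by (simp flip: not_in_keys_iff_lookup_eq_zero)
      then show ?thesis by simp
    qed (use rel in auto)
    finally show "Poly_Mapping.lookup (\<Sum>a\<in>T. cpoly_const (c a) * b a) \<mu> = Poly_Mapping.lookup 0 \<mu>"
      by simp
  qed
  \<comment> \<open>\<open>\<Sum> c\<^sub>a / (x - a)\<close> multiplied by the common denominator; at a point \<open>a\<close> of \<open>T\<close> only the summand
    of index \<open>a\<close> survives.\<close>
  define r where "r = (\<Sum>a\<in>T. smult (c a) (\<Prod>a'\<in>T - {a}. [:- of_real a', 1:]))"
  have "r \<noteq> 0"
  proof -
    obtain a where a: "a \<in> T" "c a \<noteq> 0" using c by blast
    have "poly r (of_real a) =
        (\<Sum>a''\<in>T. c a'' * (\<Prod>a'\<in>T - {a''}. complex_of_real a - of_real a'))"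
      by (simp add: r_def poly_sum poly_prod)
    also have "\<dots> = (\<Sum>a''\<in>T. if a'' = a then c a * (\<Prod>a'\<in>T - {a}. complex_of_real a - of_real a') else 0)"
      using a T(1) by (intro sum.cong) (auto intro!: prod_zero)
    also have "\<dots> \<noteq> 0"
      using a T(1) by simp
    finally show ?thesis by auto
  qed
  let ?k = "k a\<^sub>0"
  have "h ^ ?k * at_cpoly r x =
      (\<Sum>a\<in>T. cpoly_const (c a) * (\<Prod>a'\<in>T - {a}. ?x a') * (h ^ ?k - b a * ?x a)) +
      (\<Sum>a\<in>T. cpoly_const (c a) * (\<Prod>a'\<in>T - {a}. ?x a') * (b a * ?x a))"
    unfolding sum.distrib[symmetric] r_def at_cpoly_sum at_cpoly_smult at_cpoly_prod_linear sum_distrib_left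
    by (intro sum.cong) (simp_all add: algebra_simps)
  also have "(\<Sum>a\<in>T. cpoly_const (c a) * (\<Prod>a'\<in>T - {a}. ?x a') * (b a * ?x a)) =
      (\<Prod>a\<in>T. ?x a) * (\<Sum>a\<in>T. cpoly_const (c a) * b a)"
    unfolding sum_distrib_left using T(1) by (intro sum.cong) (simp_all add: prod.remove[of T] mult_ac)
  also have "\<dots> = 0" by (simp add: dependent)
  finally have "h ^ ?k * at_cpoly r x =
      (\<Sum>a\<in>T. cpoly_const (c a) * (\<Prod>a'\<in>T - {a}. ?x a') * (h ^ ?k - b a * ?x a))"
    by simp
  also have "\<dots> \<in> M"
  proof (rule prime_ideal_sum_mem[OF M(1)])
    fix a assume "a \<in> T"
    then have "k a = ?k" using T(3) by auto
    then show "cpoly_const (c a) * (\<Prod>a'\<in>T - {a}. ?x a') * (h ^ ?k - b a * ?x a) \<in> M"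
      using kb[of a] by (intro prime_idealD(3)[OF M(1)]) simp
  qed
  finally have "h ^ ?k \<in> M \<or> at_cpoly r x \<in> M"
    by (rule prime_idealD(6)[OF M(1)])
  moreover have "h ^ ?k \<notin> M"
    using prime_ideal_power_mem[OF M(1)] M(2) by blast
  ultimately have "at_cpoly r x \<in> M" by blast
  then show False
    using root_modulo_prime[OF M(1) \<open>r \<noteq> 0\<close>] none that by blast
qed

text \<open>Modulo the ideal \<open>M\<close> of \<open>prime_ideal_avoiding_powers\<close> every variable is congruent to a complex
  number, so reduction modulo \<open>M\<close> is evaluation at a complex point.\<close>

theorem nullstellensatz_countable:
  fixes P :: "'v cpoly set"
  assumes "countable (UNIV :: 'v set)" "prime_ideal P" "h \<notin> P"
  obtains \<sigma> where "\<And>p. p \<in> P \<Longrightarrow> cpoly_eval \<sigma> p = 0" "cpoly_eval \<sigma> h \<noteq> 0"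
proof -
  obtain M where M: "prime_ideal M" "P \<subseteq> M" "h \<notin> M" "\<And>y. y \<notin> M \<Longrightarrow> \<exists>k b. h ^ k - b * y \<in> M"
    using prime_ideal_avoiding_powers[OF assms(2,3)] by metis
  have "\<exists>\<rho>. cpoly_var v - cpoly_const \<rho> \<in> M" for v
    using value_modulo_maximal[OF assms(1) M(1,3,4)] by metis
  then obtain \<sigma> where \<sigma>: "\<And>v. cpoly_var v - cpoly_const (\<sigma> v) \<in> M" by metis
  have residue: "p - cpoly_const (cpoly_eval \<sigma> p) \<in> M" for p
  proof (induction p rule: cpoly_induct)
    case (add p q)
    have "p + q - cpoly_const (cpoly_eval \<sigma> (p + q)) =
        (p - cpoly_const (cpoly_eval \<sigma> p)) + (q - cpoly_const (cpoly_eval \<sigma> q))"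
      by (simp add: cpoly_const_simps)
    then show ?case using prime_idealD(2)[OF M(1) add] by (simp only:)
  next
    case (mult p q)
    have "p * q - cpoly_const (cpoly_eval \<sigma> (p * q)) =
        q * (p - cpoly_const (cpoly_eval \<sigma> p)) + cpoly_const (cpoly_eval \<sigma> p) * (q - cpoly_const (cpoly_eval \<sigma> q))"
      by (simp add: cpoly_const_simps algebra_simps)
    then show ?case
      using prime_idealD(2)[OF M(1) prime_idealD(3)[OF M(1) mult(1)] prime_idealD(3)[OF M(1) mult(2)]]
      by (simp only:)
  qed (use \<sigma> prime_idealD(1)[OF M(1)] in auto)
  have "p \<in> M \<longleftrightarrow> cpoly_eval \<sigma> p = 0" for p
  proof
    assume "p \<in> M"
    from prime_idealD(7)[OF M(1) this residue[of p]] show "cpoly_eval \<sigma> p = 0"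
      using prime_ideal_const_mem[OF M(1)] by simp
  qed (use residue[of p] in \<open>simp add: cpoly_const_simps\<close>)
  then show ?thesis using that[of \<sigma>] M(2,3) by blast
qed

section \<open>Irreducible components of a spectrum\<close>

abbreviation vanishing_locus :: "'a::comm_ring_1 set \<Rightarrow> 'a set \<Rightarrow> 'a set set" where
  "vanishing_locus E Q \<equiv> {P \<in> spec_points E. Q \<subseteq> P}"

lemma closedin_spec_mod: "closedin (spec_mod E) C \<longleftrightarrow> (\<exists>S. C = vanishing_locus E S)"
proof
  assume "closedin (spec_mod E) C"
  then have C: "C \<subseteq> spec_points E" "openin (spec_mod E) (spec_points E - C)"
    by (auto simp: closedin_def topspace_spec_mod)
  then obtain S where "spec_points E - C = {P \<in> spec_points E. \<not> S \<subseteq> P}"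
    by (auto simp: openin_spec_mod)
  then have "C = vanishing_locus E S" using C(1) by blast
  then show "\<exists>S. C = vanishing_locus E S" ..
next
  assume "\<exists>S. C = vanishing_locus E S"
  then obtain S where S: "C = vanishing_locus E S" ..
  then have "spec_points E - C = {P \<in> spec_points E. \<not> S \<subseteq> P}" by blast
  then have "openin (spec_mod E) (spec_points E - C)"
    unfolding openin_spec_mod by blast
  then show "closedin (spec_mod E) C"
    using S by (auto simp: closedin_def topspace_spec_mod)
qed

lemma closedin_vanishing_locus: "closedin (spec_mod E) (vanishing_locus E S)"
  unfolding closedin_spec_mod by blast

text \<open>\<open>Q\<close> is the generic point of \<open>vanishing_locus E Q\<close>.\<close>

lemma closedin_contains_vanishing_locus:
  assumes "closedin (spec_mod E) C" "Q \<in> C"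
  shows "vanishing_locus E Q \<subseteq> C"
  using assms unfolding closedin_spec_mod by blast

lemma irreducible_vanishing_locus:
  assumes "Q \<in> spec_points E"
  shows "irreducible_in (spec_mod E) (vanishing_locus E Q)"
  unfolding irreducible_in_def topspace_spec_mod
proof (intro conjI allI impI)
  show "vanishing_locus E Q \<noteq> {}" using assms by blast
  fix C D assume "closedin (spec_mod E) C \<and> closedin (spec_mod E) D \<and> vanishing_locus E Q \<subseteq> C \<union> D"
  moreover from this have "Q \<in> C \<or> Q \<in> D" using assms by blast
  ultimately show "vanishing_locus E Q \<subseteq> C \<or> vanishing_locus E Q \<subseteq> D"
    using closedin_contains_vanishing_locus by metis
qed auto

lemma irreducible_in_finite_cover:
  assumes "irreducible_in T S" "finite J" "\<And>j. j \<in> J \<Longrightarrow> closedin T (C j)" "S \<subseteq> (\<Union>j\<in>J. C j)"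
  obtains j where "j \<in> J" "S \<subseteq> C j"
proof -
  have "\<exists>j\<in>J. S \<subseteq> C j"
    using assms(2-4)
  proof induction
    case empty
    then show ?case using assms(1) by (simp add: irreducible_in_def)
  next
    case (insert i J)
    have "closedin T (\<Union>j\<in>J. C j)"
      using insert by (intro closedin_Union) auto
    then have "S \<subseteq> C i \<or> S \<subseteq> (\<Union>j\<in>J. C j)"
      using assms(1) insert.prems unfolding irreducible_in_def by simp
    then show ?case using insert by auto
  qed
  then show ?thesis using that by blast
qed

text \<open>The components of a spectrum are the loci of its minimal primes; finitely many primes are the
  minimal ones as soon as they are incomparable and every prime contains one of them.\<close>

lemma irreducible_components_spec_mod:
  assumes "finite I" and points: "\<And>i. i \<in> I \<Longrightarrow> Q i \<in> spec_points E"
    and cover: "\<And>P. P \<in> spec_points E \<Longrightarrow> \<exists>i\<in>I. Q i \<subseteq> P"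
    and incomparable: "\<And>i j. i \<in> I \<Longrightarrow> j \<in> I \<Longrightarrow> Q i \<subseteq> Q j \<Longrightarrow> i = j"
  shows "bij_betw (\<lambda>i. vanishing_locus E (Q i)) I (irreducible_components (spec_mod E))"
proof -
  have inside: "\<exists>i\<in>I. S \<subseteq> vanishing_locus E (Q i)" if S: "irreducible_in (spec_mod E) S" for S
  proof -
    have "S \<subseteq> spec_points E"
      using S by (simp add: irreducible_in_def topspace_spec_mod)
    then have "S \<subseteq> (\<Union>i\<in>I. vanishing_locus E (Q i))" using cover by blast
    then obtain i where "i \<in> I" "S \<subseteq> vanishing_locus E (Q i)"
      by (rule irreducible_in_finite_cover[OF S \<open>finite I\<close> closedin_vanishing_locus])
    then show ?thesis ..
  qed
  have mono: "i = j" if "i \<in> I" "j \<in> I" "vanishing_locus E (Q i) \<subseteq> vanishing_locus E (Q j)" for i j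
    using that points[of i] incomparable[of j i] by blast
  have component: "vanishing_locus E (Q i) \<in> irreducible_components (spec_mod E)" if i: "i \<in> I" for i
    unfolding irreducible_components_def
  proof (intro CollectI conjI allI impI)
    show "irreducible_in (spec_mod E) (vanishing_locus E (Q i))"
      using irreducible_vanishing_locus points i by blast
    fix S assume S: "irreducible_in (spec_mod E) S \<and> vanishing_locus E (Q i) \<subseteq> S"
    then obtain j where j: "j \<in> I" "S \<subseteq> vanishing_locus E (Q j)" using inside by blast
    have le: "vanishing_locus E (Q i) \<subseteq> S" using S by (rule conjunct2)
    have "i = j" by (rule mono[OF i j(1) order_trans[OF le j(2)]])
    then show "S = vanishing_locus E (Q i)" using le j(2) by (metis subset_antisym)
  qed
  have all: "S \<in> (\<lambda>i. vanishing_locus E (Q i)) ` I" if S: "S \<in> irreducible_components (spec_mod E)" for S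
  proof -
    have irr: "irreducible_in (spec_mod E) S"
      and maximal: "\<And>S'. irreducible_in (spec_mod E) S' \<Longrightarrow> S \<subseteq> S' \<Longrightarrow> S' = S"
      using S by (auto simp: irreducible_components_def)
    obtain i where i: "i \<in> I" "S \<subseteq> vanishing_locus E (Q i)" using inside[OF irr] by blast
    have "vanishing_locus E (Q i) = S"
      by (rule maximal[OF irreducible_vanishing_locus[OF points[OF i(1)]] i(2)])
    then show ?thesis using i(1) by blast
  qed
  have "inj_on (\<lambda>i. vanishing_locus E (Q i)) I"
  proof (rule inj_onI)
    fix i j assume "i \<in> I" "j \<in> I" "vanishing_locus E (Q i) = vanishing_locus E (Q j)"
    from this(1,2) equalityD1[OF this(3)] show "i = j" by (rule mono)
  qed
  then show ?thesis
    unfolding bij_betw_def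
    by (intro conjI equalityI image_subsetI subsetI component all)
qed

section \<open>Formal arcs as complex points\<close>

definition fps_eval :: "('v \<Rightarrow> complex) \<Rightarrow> 'v cpoly fps \<Rightarrow> complex fps" where
  "fps_eval \<sigma> A = Abs_fps (\<lambda>k. cpoly_eval \<sigma> (fps_nth A k))"

lemma fps_eval_nth [simp]: "fps_nth (fps_eval \<sigma> A) k = cpoly_eval \<sigma> (fps_nth A k)"
  by (simp add: fps_eval_def)

lemma fps_eval_diff [simp]: "fps_eval \<sigma> (A - B) = fps_eval \<sigma> A - fps_eval \<sigma> B"
  by (rule fps_ext) simp

lemma fps_eval_mult [simp]: "fps_eval \<sigma> (A * B) = fps_eval \<sigma> A * fps_eval \<sigma> B"
  by (rule fps_ext) (simp add: fps_mult_nth)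

lemma fps_eval_1 [simp]: "fps_eval \<sigma> 1 = 1"
  by (rule fps_ext) simp

lemma fps_eval_power [simp]: "fps_eval \<sigma> (A ^ k) = fps_eval \<sigma> A ^ k"
  by (induction k) auto

lemma fps_eval_prod [simp]: "fps_eval \<sigma> (\<Prod>x\<in>S. A x) = (\<Prod>x\<in>S. fps_eval \<sigma> (A x))"
  by (induction S rule: infinite_finite_induct) auto

lemma fps_eval_generic_series [simp]:
  "fps_eval \<sigma> (generic_series x) = fps_X * Abs_fps (\<lambda>k. \<sigma> (x k))"
  by (rule fps_ext) (simp add: generic_series_def fps_X_mult_nth del: fps_eval_mult)

lemma fps_eval_subst_series [simp]:
  "fps_eval \<sigma> (subst_series (\<lambda>\<alpha>. cpoly_const (c \<alpha>)) \<phi>) = subst_series c (\<chi> i. fps_eval \<sigma> (\<phi> $ i))"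
proof (rule fps_ext)
  fix k
  have "cpoly_eval \<sigma> (fps_nth (\<Prod>i\<in>UNIV. \<phi> $ i ^ \<alpha> i) k) =
      fps_nth (\<Prod>i\<in>UNIV. fps_eval \<sigma> (\<phi> $ i) ^ \<alpha> i) k" for \<alpha>
    by (simp flip: fps_eval_nth)
  then show "fps_nth (fps_eval \<sigma> (subst_series (\<lambda>\<alpha>. cpoly_const (c \<alpha>)) \<phi>)) k =
      fps_nth (subst_series c (\<chi> i. fps_eval \<sigma> (\<phi> $ i))) k"
    by (simp add: subst_series_def del: fps_eval_prod)
qed

lemma fps_X_mult_tail: "fps_nth A 0 = 0 \<Longrightarrow> fps_X * Abs_fps (\<lambda>k. fps_nth A (Suc k)) = (A :: 'a::comm_ring_1 fps)"
  by (rule fps_ext) (simp add: fps_X_mult_nth)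

lemma fps_eval_arc_equation:
  assumes "fps_nth \<psi>1 0 = 0" "fps_nth \<psi>2 0 = 0" "\<And>i. fps_nth (\<phi> $ i) 0 = 0"
  shows "fps_eval (arc_coord (\<psi>1, \<psi>2, \<phi>)) (arc_equation f) = \<psi>1 * \<psi>2 - compose_arc f \<phi>"
proof -
  have "(\<chi> i. fps_eval (arc_coord (\<psi>1, \<psi>2, \<phi>)) ((\<chi> i. generic_series (Phi i)) $ i)) = \<phi>"
    using assms by (simp add: vec_eq_iff fps_X_mult_tail)
  then show ?thesis
    using assms by (simp add: arc_equation_def fps_X_mult_tail)
qed

lemma prime_ideal_arc_point: "prime_ideal (arc_point a)"
  by (auto simp: prime_ideal_def arc_point_def)

lemma arc_point_in_arc_space:
  assumes "a \<in> formal_arcs f"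
  shows "arc_point a \<in> spec_points (range (fps_nth (arc_equation f)))"
proof -
  obtain \<psi>1 \<psi>2 \<phi> where a: "a = (\<psi>1, \<psi>2, \<phi>)" by (cases a)
  have "fps_eval (arc_coord a) (arc_equation f) = 0"
    using assms by (auto simp: a formal_arcs_def fps_eval_arc_equation)
  then have "cpoly_eval (arc_coord a) (fps_nth (arc_equation f) k) = 0" for k
    by (metis fps_eval_nth fps_zero_nth)
  then have "range (fps_nth (arc_equation f)) \<subseteq> arc_point a"
    by (auto simp: arc_point_def)
  then show ?thesis
    using prime_ideal_arc_point[of a] by (simp add: spec_points_def)
qed

text \<open>Together with \<open>arc_point_in_arc_space\<close>: the complex zeros of the defining equations of the
  arc scheme are the coefficient vectors of formal arcs.\<close>

lemma arc_of_complex_point: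
  assumes "\<And>k. cpoly_eval \<sigma> (fps_nth (arc_equation f) k) = 0"
  obtains a where "a \<in> formal_arcs f" "arc_coord a = \<sigma>"
proof -
  let ?A = "\<lambda>x. fps_X * Abs_fps (\<lambda>k. \<sigma> (x k))"
  define a where "a = (?A Psi1, ?A Psi2, \<chi> i. ?A (Phi i))"
  have coord: "arc_coord a = \<sigma>"
  proof
    show "arc_coord a v = \<sigma> v" for v by (cases v) (simp_all add: a_def)
  qed
  have "fps_eval \<sigma> (arc_equation f) = 0"
    by (rule fps_ext) (simp add: assms)
  then have "fps_eval (arc_coord a) (arc_equation f) = 0" by (simp add: coord)
  then have "a \<in> formal_arcs f"
    unfolding a_def by (subst (asm) fps_eval_arc_equation) (auto simp: formal_arcs_def)
  then show ?thesis using that coord by blast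
qed

lemma countable_arc_vars: "countable (UNIV :: 'n::finite arc_var set)"
proof -
  have "(UNIV :: 'n arc_var set) = range Psi1 \<union> range Psi2 \<union> (\<Union>i. range (Phi i))"
    by (auto simp: image_iff) (metis arc_var.exhaust)
  also have "countable \<dots>" by auto
  finally show ?thesis .
qed

section \<open>Substitution of arcs and the leading form\<close>

lemma finite_mdegree_le: "finite {\<alpha> :: 'n::finite \<Rightarrow> nat. mdegree \<alpha> \<le> k}"
proof (rule finite_subset)
  show "{\<alpha> :: 'n \<Rightarrow> nat. mdegree \<alpha> \<le> k} \<subseteq> PiE UNIV (\<lambda>_. {..k})"
  proof (intro subsetI PiE_I)
    fix \<alpha> :: "'n \<Rightarrow> nat" and i assume "\<alpha> \<in> {\<alpha>. mdegree \<alpha> \<le> k}"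
    then show "\<alpha> i \<in> {..k}"
      using member_le_sum[of i UNIV \<alpha>] by (simp add: mdegree_def)
  qed auto
qed (simp add: finite_PiE)

definition leading_form :: "(('n::finite \<Rightarrow> nat) \<Rightarrow> complex) \<Rightarrow> nat \<Rightarrow> ('n \<Rightarrow> complex) \<Rightarrow> complex" where
  "leading_form c m z = (\<Sum>\<alpha> | mdegree \<alpha> = m. c \<alpha> * (\<Prod>i\<in>UNIV. z i ^ \<alpha> i))"

lemma monomial_of_arc:
  fixes \<phi> :: "complex fps ^ 'n::finite"
  assumes "\<And>i. fps_nth (\<phi> $ i) 0 = 0"
  obtains B where "(\<Prod>i\<in>UNIV. (\<phi> $ i) ^ \<alpha> i) = fps_X ^ mdegree \<alpha> * B"
    "fps_nth B 0 = (\<Prod>i\<in>UNIV. fps_nth (\<phi> $ i) 1 ^ \<alpha> i)"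
proof -
  define w where "w = (\<lambda>i. Abs_fps (\<lambda>k. fps_nth (\<phi> $ i) (Suc k)))"
  have "\<phi> $ i = fps_X * w i" for i
    using fps_X_mult_tail[OF assms] by (simp add: w_def)
  then have "(\<Prod>i\<in>UNIV. (\<phi> $ i) ^ \<alpha> i) = fps_X ^ mdegree \<alpha> * (\<Prod>i\<in>UNIV. w i ^ \<alpha> i)"
    by (simp add: power_mult_distrib prod.distrib mdegree_def power_sum)
  moreover have "fps_nth (\<Prod>i\<in>S. w i ^ \<alpha> i) 0 = (\<Prod>i\<in>S. fps_nth (\<phi> $ i) 1 ^ \<alpha> i)" for S
    by (induction S rule: infinite_finite_induct) (simp_all add: fps_power_zeroth w_def)
  ultimately show ?thesis using that by blast
qed

lemma
  fixes c :: "('n::finite \<Rightarrow> nat) \<Rightarrow> complex"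
  assumes c: "\<And>\<alpha>. c \<alpha> \<noteq> 0 \<Longrightarrow> m \<le> mdegree \<alpha>" and \<phi>: "\<And>i. fps_nth (\<phi> $ i) 0 = 0"
  shows subst_series_nth_less: "k < m \<Longrightarrow> fps_nth (subst_series c \<phi>) k = 0"
    and subst_series_nth_leading: "fps_nth (subst_series c \<phi>) m = leading_form c m (\<lambda>i. fps_nth (\<phi> $ i) 1)"
proof -
  assume "k < m"
  then have "c \<alpha> = 0" if "mdegree \<alpha> \<le> k" for \<alpha>
    using c[of \<alpha>] that by fastforce
  then show "fps_nth (subst_series c \<phi>) k = 0"
    by (simp add: subst_series_def)
next
  have term_eq: "c \<alpha> * fps_nth (\<Prod>i\<in>UNIV. (\<phi> $ i) ^ \<alpha> i) m = c \<alpha> * (\<Prod>i\<in>UNIV. fps_nth (\<phi> $ i) 1 ^ \<alpha> i)"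
    if "mdegree \<alpha> = m" for \<alpha>
  proof -
    obtain B where "(\<Prod>i\<in>UNIV. (\<phi> $ i) ^ \<alpha> i) = fps_X ^ mdegree \<alpha> * B"
      "fps_nth B 0 = (\<Prod>i\<in>UNIV. fps_nth (\<phi> $ i) 1 ^ \<alpha> i)"
      by (rule monomial_of_arc[OF \<phi>])
    then show ?thesis using that by (simp add: fps_X_power_mult_nth)
  qed
  have "leading_form c m (\<lambda>i. fps_nth (\<phi> $ i) 1) =
      (\<Sum>\<alpha> | mdegree \<alpha> = m. c \<alpha> * fps_nth (\<Prod>i\<in>UNIV. (\<phi> $ i) ^ \<alpha> i) m)"
    unfolding leading_form_def by (intro sum.cong refl term_eq[symmetric]) simp
  also have "\<dots> = fps_nth (subst_series c \<phi>) m"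
    unfolding subst_series_def fps_nth_Abs_fps
  proof (intro sum.mono_neutral_left ballI finite_mdegree_le)
    fix \<alpha> :: "'n \<Rightarrow> nat" assume "\<alpha> \<in> {\<alpha>. mdegree \<alpha> \<le> m} - {\<alpha>. mdegree \<alpha> = m}"
    then have "c \<alpha> = 0" using c[of \<alpha>] by fastforce
    then show "c \<alpha> * fps_nth (\<Prod>i\<in>UNIV. (\<phi> $ i) ^ \<alpha> i) m = 0" by simp
  qed auto
  finally show "fps_nth (subst_series c \<phi>) m = leading_form c m (\<lambda>i. fps_nth (\<phi> $ i) 1)" ..
qed

text \<open>Artin's argument: comparing the relation at \<open>y x\<close> with \<open>\<xi> b y\<close> times the relation at \<open>x\<close>
  eliminates the character \<open>\<xi> b\<close>.\<close>

lemma linear_independence_of_characters: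
  fixes \<xi> :: "'a \<Rightarrow> 'g \<Rightarrow> 'k::field" and times :: "'g \<Rightarrow> 'g \<Rightarrow> 'g" and one :: 'g
  assumes "finite T" "\<And>a x y. \<xi> a (times x y) = \<xi> a x * \<xi> a y" "\<And>a. \<xi> a one = 1" "inj \<xi>"
    and "\<And>x. (\<Sum>a\<in>T. c a * \<xi> a x) = 0" "a \<in> T"
  shows "c a = 0"
  using assms(1,5,6)
proof (induction T arbitrary: c a)
  case (insert b T)
  have zero: "c a = 0" if "a \<in> T" for a
  proof -
    have "a \<noteq> b" using insert.hyps that by blast
    then obtain y where y: "\<xi> a y \<noteq> \<xi> b y"
      using \<open>inj \<xi>\<close> by (metis ext injD)
    have "(\<Sum>a\<in>T. c a * (\<xi> a y - \<xi> b y) * \<xi> a x) = 0" for x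
    proof -
      have "(\<Sum>a\<in>T. c a * (\<xi> a y - \<xi> b y) * \<xi> a x) =
          (\<Sum>a\<in>insert b T. c a * (\<xi> a y - \<xi> b y) * \<xi> a x)"
        using insert.hyps by simp
      also have "\<dots> = (\<Sum>a\<in>insert b T. c a * \<xi> a (times y x)) - \<xi> b y * (\<Sum>a\<in>insert b T. c a * \<xi> a x)"
        unfolding sum_distrib_left sum_subtractf[symmetric] using assms(2)
        by (intro sum.cong) (simp_all add: algebra_simps)
      also have "\<dots> = 0" by (simp only: insert.prems(1)) simp
      finally show ?thesis .
    qed
    from insert.IH[OF this that] y show ?thesis by simp
  qed
  moreover have "c b = 0"
    using insert.prems(1)[of one] insert.hyps zero assms(3) by simp
  ultimately show ?case using insert.prems by blast
qed simp


text \<open>Monomials are characters of the multiplicative monoid \<open>\<complex>\<^sup>n\<close>, and distinct monomials are distinct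
  characters: they differ at a vector with one entry \<open>2\<close> and all others \<open>1\<close>.\<close>

lemma leading_form_nonzero:
  fixes c :: "('n::finite \<Rightarrow> nat) \<Rightarrow> complex"
  assumes "c \<alpha> \<noteq> 0" "mdegree \<alpha> = m"
  obtains z where "leading_form c m z \<noteq> 0"
proof -
  let ?\<xi> = "\<lambda>(\<alpha> :: 'n \<Rightarrow> nat) z. \<Prod>i\<in>UNIV. (z i :: complex) ^ \<alpha> i"
  have separate: "\<alpha> = \<beta>" if "?\<xi> \<alpha> = ?\<xi> \<beta>" for \<alpha> \<beta> :: "'n \<Rightarrow> nat"
  proof
    fix j
    have "(\<Prod>i\<in>UNIV. (if i = j then 2 else 1) ^ \<gamma> i) = (2 :: complex) ^ \<gamma> j" for \<gamma> :: "'n \<Rightarrow> nat"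
    proof -
      have "(\<Prod>i\<in>UNIV. (if i = j then 2 else 1) ^ \<gamma> i) =
          (\<Prod>i\<in>UNIV. if i = j then (2 :: complex) ^ \<gamma> j else 1)"
        by (intro prod.cong) auto
      then show ?thesis by simp
    qed
    then have "(2 :: complex) ^ \<alpha> j = 2 ^ \<beta> j"
      using fun_cong[OF that, of "\<lambda>i. if i = j then 2 else 1"] by simp
    then have "(2 :: nat) ^ \<alpha> j = 2 ^ \<beta> j"
      by (metis of_nat_eq_iff of_nat_numeral of_nat_power)
    then show "\<alpha> j = \<beta> j" by simp
  qed
  have distinct: "inj ?\<xi>"
    by (intro injI) (erule separate)
  show ?thesis
  proof (rule ccontr)
    assume none: "\<not> thesis"
    have "c \<alpha> = 0"
    proof (rule linear_independence_of_characters[where T = "{\<alpha>. mdegree \<alpha> = m}" and \<xi> = ?\<xi>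
          and one = "\<lambda>_. 1" and times = "\<lambda>x y i. x i * y i"])
      show "finite {\<alpha> :: 'n \<Rightarrow> nat. mdegree \<alpha> = m}"
        by (rule finite_subset[OF _ finite_mdegree_le[of m]]) auto
      show "(\<Sum>\<alpha> | mdegree \<alpha> = m. c \<alpha> * ?\<xi> \<alpha> z) = 0" for z
        using none that by (auto simp: leading_form_def)
    qed (use assms distinct in \<open>auto simp: power_mult_distrib prod.distrib\<close>)
    then show False using assms by blast
  qed
qed

section \<open>Multiplication of monic polynomials is an open map\<close>

text \<open>The value at \<open>z\<close> of a monic polynomial is the product of the differences of \<open>z\<close> and the roots;
  the smallest of them is bounded by the geometric mean.\<close>

lemma nearby_root:
  fixes p :: "complex poly"
  assumes "lead_coeff p = 1" "degree p > 0"
  obtains r where "poly p r = 0" "norm (z - r) ^ degree p \<le> norm (poly p z)"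
proof -
  have "\<exists>r. poly p r = 0 \<and> norm (z - r) ^ degree p \<le> norm (poly p z)"
    using assms
  proof (induction "degree p" arbitrary: p)
    case (Suc n)
    then obtain r where "poly p r = 0"
      using fundamental_theorem_of_algebra[of p] constant_degree[of p] by auto
    then obtain q where q: "p = [:- r, 1:] * q"
      by (metis dvd_def poly_eq_0_iff_dvd)
    have "q \<noteq> 0" using Suc.prems q by auto
    then have deg: "degree p = Suc (degree q)"
      unfolding q by (subst degree_mult_eq) auto
    have lead: "lead_coeff q = 1"
      using Suc.prems(1) unfolding q lead_coeff_mult by simp
    have val: "norm (poly p z) = norm (z - r) * norm (poly q z)"
      by (simp add: q norm_mult[symmetric] algebra_simps)
    show ?case
    proof (cases "degree q = 0")
      case True
      then have "q = 1" using lead by (metis degree_eq_zeroE lead_coeff_pCons(2) one_pCons)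
      then show ?thesis using \<open>poly p r = 0\<close> val deg by (intro exI[of _ r]) auto
    next
      case False
      then obtain r' where r': "poly q r' = 0" "norm (z - r') ^ degree q \<le> norm (poly q z)"
        using Suc.hyps(1)[of q] lead deg Suc.hyps(2) by auto
      show ?thesis
      proof (cases "norm (z - r) \<le> norm (z - r')")
        case True
        then have "norm (z - r) ^ degree q \<le> norm (poly q z)"
          using r'(2) power_mono[of "norm (z - r)" "norm (z - r')" "degree q"] by simp
        then have "norm (z - r) ^ degree p \<le> norm (poly p z)"
          unfolding val deg by (simp add: mult_left_mono)
        then show ?thesis using \<open>poly p r = 0\<close> by blast
      next
        case False
        then have "norm (z - r') ^ degree p \<le> norm (poly p z)"
          unfolding val deg power_Suc using r'(2) by (intro mult_mono) auto
        moreover have "poly p r' = 0" by (simp add: q r'(1) del: mult_pCons_left)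
        ultimately show ?thesis by blast
      qed
    qed
  qed simp
  then show ?thesis using that by blast
qed

text \<open>Induction on the degree of \<open>a\<close>. A root \<open>z\<close> of \<open>a\<close> is the limit of roots \<open>\<rho>\<close> of \<open>p\<close>, because the
  value of \<open>p\<close> at \<open>z\<close> tends to \<open>0\<close>. Dividing by the linear factors \<open>x - \<rho>\<close> and \<open>x - z\<close> is continuous
  in the coefficients, and the quotients deform a product with a factor of smaller degree.\<close>

lemma monic_factors_deform:
  fixes a b :: "complex poly" and p :: "'s \<Rightarrow> complex poly"
  assumes "lead_coeff a = 1" "lead_coeff b = 1"
    and "\<And>s. lead_coeff (p s) = 1" "\<And>s. degree (p s) = degree (a * b)"
    and "\<And>k. ((\<lambda>s. coeff (p s) k) \<longlongrightarrow> coeff (a * b) k) F"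
  obtains a' b' where "\<And>s. p s = a' s * b' s"
    "\<And>k. ((\<lambda>s. coeff (a' s) k) \<longlongrightarrow> coeff a k) F"
    "\<And>k. ((\<lambda>s. coeff (b' s) k) \<longlongrightarrow> coeff b k) F"
proof -
  have "\<exists>a' b'. (\<forall>s. p s = a' s * b' s) \<and>
      (\<forall>k. ((\<lambda>s. coeff (a' s) k) \<longlongrightarrow> coeff a k) F) \<and>
      (\<forall>k. ((\<lambda>s. coeff (b' s) k) \<longlongrightarrow> coeff b k) F)"
    using assms
  proof (induction "degree a" arbitrary: a p)
    case 0
    then have "a = 1" by (metis degree_eq_zeroE lead_coeff_pCons(2) one_pCons)
    then show ?case using 0 by (intro exI[of _ "\<lambda>_. 1"] exI[of _ p]) auto
  next
    case (Suc n)
    then obtain z where "poly a z = 0"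
      using fundamental_theorem_of_algebra[of a] constant_degree[of a] by auto
    then obtain a\<^sub>1 where a\<^sub>1: "a = [:- z, 1:] * a\<^sub>1"
      by (metis dvd_def poly_eq_0_iff_dvd)
    have nz: "a\<^sub>1 \<noteq> 0" "b \<noteq> 0" using Suc.prems a\<^sub>1 by auto
    have deg_a: "degree a = Suc (degree a\<^sub>1)"
      unfolding a\<^sub>1 using nz by (subst degree_mult_eq) auto
    have lead_a: "lead_coeff a\<^sub>1 = 1"
      using Suc.prems(1) unfolding a\<^sub>1 lead_coeff_mult by simp
    define d where "d = degree (a\<^sub>1 * b)"
    have deg_p: "degree (p s) = Suc d" for s
    proof -
      have "a \<noteq> 0" using deg_a by auto
      then show ?thesis
        using Suc.prems(4)[of s] nz deg_a by (simp add: d_def degree_mult_eq)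
    qed
    have "\<exists>r. poly (p s) r = 0 \<and> norm (z - r) ^ Suc d \<le> norm (poly (p s) z)" for s
      using nearby_root[of "p s" z] Suc.prems(3)[of s] deg_p[of s] by (metis zero_less_Suc)
    then obtain \<rho> where \<rho>: "\<And>s. poly (p s) (\<rho> s) = 0"
      "\<And>s. norm (z - \<rho> s) ^ Suc d \<le> norm (poly (p s) z)"
      by metis
    have "((\<lambda>s. \<Sum>k\<le>Suc d. coeff (p s) k * z ^ k) \<longlongrightarrow> (\<Sum>k\<le>Suc d. coeff (a * b) k * z ^ k)) F"
      by (intro tendsto_intros Suc.prems(5))
    moreover have "(\<Sum>k\<le>Suc d. coeff (a * b) k * z ^ k) = poly (a * b) z"
      using Suc.prems(4) deg_p by (simp add: poly_altdef)
    moreover have "(\<Sum>k\<le>Suc d. coeff (p s) k * z ^ k) = poly (p s) z" for s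
      using deg_p[of s] by (simp add: poly_altdef)
    ultimately have value_0: "((\<lambda>s. poly (p s) z) \<longlongrightarrow> 0) F"
      using \<open>poly a z = 0\<close> by simp
    have \<rho>_lim: "(\<rho> \<longlongrightarrow> z) F"
    proof (rule tendstoI)
      fix e :: real assume "e > 0"
      then have "eventually (\<lambda>s. dist (poly (p s) z) 0 < e ^ Suc d) F"
        using value_0 by (intro tendstoD) auto
      then show "eventually (\<lambda>s. dist (\<rho> s) z < e) F"
      proof eventually_elim
        case (elim s)
        then have "norm (z - \<rho> s) ^ Suc d < e ^ Suc d"
          using \<rho>(2)[of s] by (simp add: dist_norm del: power_Suc)
        then show ?case
          using \<open>e > 0\<close> power_less_imp_less_base[of "norm (z - \<rho> s)" "Suc d" e]
          by (simp add: dist_norm norm_minus_commute)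
      qed
    qed
    have "\<exists>q. p s = [:- \<rho> s, 1:] * q" for s
      using \<rho>(1)[of s] by (metis dvd_def poly_eq_0_iff_dvd)
    then obtain q where q: "\<And>s. p s = [:- \<rho> s, 1:] * q s" by metis
    have q_nz: "q s \<noteq> 0" for s using q[of s] Suc.prems(3)[of s] by auto
    have deg_q: "degree (q s) = d" for s
      using deg_p[of s] q_nz[of s] unfolding q[of s] by (subst (asm) degree_mult_eq) auto
    have lead_q: "lead_coeff (q s) = 1" for s
      using Suc.prems(3)[of s] unfolding q[of s] lead_coeff_mult by simp
    have lim_large: "((\<lambda>s. coeff (q s) k) \<longlongrightarrow> coeff (a\<^sub>1 * b) k) F" if "k > d" for k
    proof -
      have "coeff (q s) k = 0" for s
        using that deg_q by (intro coeff_eq_0) simp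
      moreover have "coeff (a\<^sub>1 * b) k = 0"
        using that d_def by (intro coeff_eq_0) simp
      ultimately show ?thesis by simp
    qed
    \<comment> \<open>The coefficients of the quotient are computed from the top downwards.\<close>
    have lim_small: "((\<lambda>s. coeff (q s) k) \<longlongrightarrow> coeff (a\<^sub>1 * b) k) F" if "k \<le> Suc d" for k
      using that
    proof (induction rule: inc_induct)
      case base
      show ?case by (rule lim_large) simp
    next
      case (step k)
      have "((\<lambda>s. coeff (p s) (Suc k) + \<rho> s * coeff (q s) (Suc k)) \<longlongrightarrow>
          coeff (a * b) (Suc k) + z * coeff (a\<^sub>1 * b) (Suc k)) F"
        by (intro tendsto_intros Suc.prems(5) \<rho>_lim step.IH)
      moreover have "coeff (p s) (Suc k) + \<rho> s * coeff (q s) (Suc k) = coeff (q s) k" for s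
        unfolding q[of s] by simp
      moreover have "coeff (a * b) (Suc k) + z * coeff (a\<^sub>1 * b) (Suc k) = coeff (a\<^sub>1 * b) k"
        unfolding a\<^sub>1 mult.assoc by simp
      ultimately show ?case by simp
    qed
    have q_lim: "((\<lambda>s. coeff (q s) k) \<longlongrightarrow> coeff (a\<^sub>1 * b) k) F" for k
      using lim_small[of k] lim_large[of k] by linarith
    have "n = degree a\<^sub>1" using Suc.hyps(2) deg_a by simp
    from Suc.hyps(1)[OF this lead_a Suc.prems(2), of q] lead_q deg_q q_lim
    obtain a' b' where ab: "\<And>s. q s = a' s * b' s"
      "\<And>k. ((\<lambda>s. coeff (a' s) k) \<longlongrightarrow> coeff a\<^sub>1 k) F"
      "\<And>k. ((\<lambda>s. coeff (b' s) k) \<longlongrightarrow> coeff b k) F"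
      unfolding d_def by metis
    have "((\<lambda>s. coeff ([:- \<rho> s, 1:] * a' s) k) \<longlongrightarrow> coeff a k) F" for k
    proof -
      have "((\<lambda>s. coeff (pCons 0 (a' s)) k - \<rho> s * coeff (a' s) k) \<longlongrightarrow>
          coeff (pCons 0 a\<^sub>1) k - z * coeff a\<^sub>1 k) F"
      proof (intro tendsto_intros \<rho>_lim ab(2))
        show "((\<lambda>s. coeff (pCons 0 (a' s)) k) \<longlongrightarrow> coeff (pCons 0 a\<^sub>1) k) F"
          by (cases k) (auto intro: ab(2))
      qed
      then show ?thesis by (simp add: a\<^sub>1)
    qed
    then show ?case
      using q ab by (intro exI[of _ "\<lambda>s. [:- \<rho> s, 1:] * a' s"] exI[of _ b'])
        (auto simp: mult.assoc simp del: mult_pCons_left)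
  qed
  then show ?thesis using that by blast
qed

definition fps_truncate_poly :: "nat \<Rightarrow> complex fps \<Rightarrow> complex poly" where
  "fps_truncate_poly N A = (\<Sum>k\<le>N. monom (fps_nth A k) k)"

lemma coeff_fps_truncate_poly: "coeff (fps_truncate_poly N A) k = (if k \<le> N then fps_nth A k else 0)"
  by (simp add: fps_truncate_poly_def coeff_sum)

lemma fps_mult_nth_cong:
  fixes A B :: "'a::comm_ring_1 fps"
  assumes "\<And>j. j \<le> k \<Longrightarrow> fps_nth A j = fps_nth A' j" "\<And>j. j \<le> k \<Longrightarrow> fps_nth B j = fps_nth B' j"
  shows "fps_nth (A * B) k = fps_nth (A' * B') k"
  unfolding fps_mult_nth using assms by (intro sum.cong) auto

text \<open>The factors are truncated and then completed by \<open>x\<^sup>N\<^sup>+\<^sup>1\<close>, which makes them monic of a known degree,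
  even if \<open>u\<close> or \<open>v\<close> is zero, and does not affect the product up to order \<open>N\<close>.\<close>

lemma fps_factors_deform:
  fixes u v :: "complex fps" and E :: "'s \<Rightarrow> complex fps"
  assumes "\<And>k. ((\<lambda>s. fps_nth (E s) k) \<longlongrightarrow> fps_nth (u * v) k) F"
  obtains u' v' where "\<And>s k. k \<le> N \<Longrightarrow> fps_nth (u' s * v' s) k = fps_nth (E s) k"
    "\<And>k. k \<le> N \<Longrightarrow> ((\<lambda>s. fps_nth (u' s) k) \<longlongrightarrow> fps_nth u k) F"
    "\<And>k. k \<le> N \<Longrightarrow> ((\<lambda>s. fps_nth (v' s) k) \<longlongrightarrow> fps_nth v k) F"
proof -
  define mk where "mk = (\<lambda>A. fps_truncate_poly N A + monom 1 (Suc N))"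
  have coeff_mk: "coeff (mk A) k = (if k \<le> N then fps_nth A k else if k = Suc N then 1 else 0)" for A k
    by (simp add: mk_def coeff_fps_truncate_poly)
  have deg_mk: "degree (mk A) = Suc N" for A
    by (intro antisym degree_le le_degree) (simp_all add: coeff_mk)
  then have lead_mk: "lead_coeff (mk A) = 1" for A
    by (simp add: coeff_mk)
  \<comment> \<open>Coincides with \<open>E s\<close> up to order \<open>N\<close> and tends to \<open>mk u * mk v\<close>.\<close>
  define p where "p = (\<lambda>s. mk u * mk v + fps_truncate_poly N (E s - u * v))"
  have deg: "degree (mk u * mk v) = 2 * Suc N"
    using lead_mk[of u] lead_mk[of v] deg_mk by (subst degree_mult_eq) auto
  have "degree (fps_truncate_poly N A) \<le> N" for A
    by (rule degree_le) (simp add: coeff_fps_truncate_poly)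
  then have less: "degree (fps_truncate_poly N A) < degree (mk u * mk v)" for A
    unfolding deg by (rule le_less_trans) simp
  have coeff_prod: "coeff (mk u * mk v) k = fps_nth (u * v) k" if "k \<le> N" for k
    using that unfolding coeff_mult fps_mult_nth atLeast0AtMost by (intro sum.cong) (auto simp: coeff_mk)
  obtain a' b' where ab: "\<And>s. p s = a' s * b' s"
    "\<And>k. ((\<lambda>s. coeff (a' s) k) \<longlongrightarrow> coeff (mk u) k) F"
    "\<And>k. ((\<lambda>s. coeff (b' s) k) \<longlongrightarrow> coeff (mk v) k) F"
  proof (rule monic_factors_deform[of "mk u" "mk v" p F])
    show "lead_coeff (p s) = 1" for s
    proof -
      have "p s = fps_truncate_poly N (E s - u * v) + mk u * mk v" by (simp add: p_def)
      then show ?thesis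
        by (simp only: lead_coeff_add_le[OF less] lead_coeff_mult lead_mk) simp
    qed
    show "degree (p s) = degree (mk u * mk v)" for s
      unfolding p_def by (rule degree_add_eq_left[OF less])
    show "((\<lambda>s. coeff (p s) k) \<longlongrightarrow> coeff (mk u * mk v) k) F" for k
    proof -
      have "((\<lambda>s. coeff (mk u * mk v) k + (if k \<le> N then fps_nth (E s) k - fps_nth (u * v) k else 0)) \<longlongrightarrow>
          coeff (mk u * mk v) k + (if k \<le> N then fps_nth (u * v) k - fps_nth (u * v) k else 0)) F"
        using assms by (auto intro!: tendsto_eq_intros)
      then show ?thesis by (cases "k \<le> N") (simp_all add: p_def coeff_fps_truncate_poly)
    qed
  qed (use lead_mk in auto)
  show ?thesis
  proof (rule that[of "\<lambda>s. fps_of_poly (a' s)" "\<lambda>s. fps_of_poly (b' s)"])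
    fix s k assume "k \<le> N"
    then show "fps_nth (fps_of_poly (a' s) * fps_of_poly (b' s)) k = fps_nth (E s) k"
      by (simp add: fps_of_poly_mult[symmetric] ab(1)[symmetric] p_def coeff_prod coeff_fps_truncate_poly)
  next
    fix k assume "k \<le> N"
    then show "((\<lambda>s. fps_nth (fps_of_poly (a' s)) k) \<longlongrightarrow> fps_nth u k) F"
      using ab(2)[of k] by (simp add: coeff_mk)
  next
    fix k assume "k \<le> N"
    then show "((\<lambda>s. fps_nth (fps_of_poly (b' s)) k) \<longlongrightarrow> fps_nth v k) F"
      using ab(3)[of k] by (simp add: coeff_mk)
  qed
qed

section \<open>Power series depending rationally on a parameter\<close>

text \<open>The functions of one complex variable that are regular where \<open>D\<close> does not vanish, i.e. the
  elements of \<open>\<complex>[s]\<close> localised at \<open>D\<close>; their values at zeros of \<open>D\<close> are arbitrary.\<close>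

definition rational_in :: "complex poly \<Rightarrow> (complex \<Rightarrow> complex) \<Rightarrow> bool" where
  "rational_in D g \<longleftrightarrow> (\<exists>k p. \<forall>s. poly D s \<noteq> 0 \<longrightarrow> g s * poly D s ^ k = poly p s)"

lemma rational_in_poly [simp]: "rational_in D (poly p)"
  unfolding rational_in_def by (intro exI[of _ 0] exI[of _ p]) simp

lemma rational_in_const [simp]: "rational_in D (\<lambda>_. a)"
  unfolding rational_in_def by (intro exI[of _ 0] exI[of _ "[:a:]"]) simp

lemma rational_in_inverse: "rational_in D (\<lambda>s. inverse (poly D s))"
  unfolding rational_in_def by (intro exI[of _ 1] exI[of _ 1]) simp

lemma rational_in_add:
  assumes "rational_in D g" "rational_in D h"
  shows "rational_in D (\<lambda>s. g s + h s)"
proof -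
  obtain k p where p: "\<And>s. poly D s \<noteq> 0 \<Longrightarrow> g s * poly D s ^ k = poly p s"
    using assms(1) unfolding rational_in_def by blast
  obtain l q where q: "\<And>s. poly D s \<noteq> 0 \<Longrightarrow> h s * poly D s ^ l = poly q s"
    using assms(2) unfolding rational_in_def by blast
  have "(g s + h s) * poly D s ^ (k + l) = poly (p * D ^ l + q * D ^ k) s" if "poly D s \<noteq> 0" for s
  proof -
    have "(g s + h s) * poly D s ^ (k + l) =
        (g s * poly D s ^ k) * poly D s ^ l + (h s * poly D s ^ l) * poly D s ^ k"
      by (simp add: power_add algebra_simps)
    then show ?thesis by (simp add: p[OF that] q[OF that])
  qed
  then show ?thesis unfolding rational_in_def by blast
qed

lemma rational_in_mult:
  assumes "rational_in D g" "rational_in D h"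
  shows "rational_in D (\<lambda>s. g s * h s)"
proof -
  obtain k p where p: "\<And>s. poly D s \<noteq> 0 \<Longrightarrow> g s * poly D s ^ k = poly p s"
    using assms(1) unfolding rational_in_def by blast
  obtain l q where q: "\<And>s. poly D s \<noteq> 0 \<Longrightarrow> h s * poly D s ^ l = poly q s"
    using assms(2) unfolding rational_in_def by blast
  have "(g s * h s) * poly D s ^ (k + l) = poly (p * q) s" if "poly D s \<noteq> 0" for s
  proof -
    have "(g s * h s) * poly D s ^ (k + l) = (g s * poly D s ^ k) * (h s * poly D s ^ l)"
      by (simp add: power_add algebra_simps)
    then show ?thesis by (simp add: p[OF that] q[OF that])
  qed
  then show ?thesis unfolding rational_in_def by blast
qed

lemma rational_in_sum: "(\<And>x. x \<in> A \<Longrightarrow> rational_in D (g x)) \<Longrightarrow> rational_in D (\<lambda>s. \<Sum>x\<in>A. g x s)"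
  by (induction A rule: infinite_finite_induct) (auto intro: rational_in_add)

lemma rational_in_cpoly_eval:
  "(\<And>v. rational_in D (\<lambda>s. \<sigma> s v)) \<Longrightarrow> rational_in D (\<lambda>s. cpoly_eval (\<sigma> s) h)"
  by (induction h rule: cpoly_induct) (auto intro: rational_in_add rational_in_mult)

definition fps_rational_in :: "complex poly \<Rightarrow> (complex \<Rightarrow> complex fps) \<Rightarrow> bool" where
  "fps_rational_in D A \<longleftrightarrow> (\<forall>k. rational_in D (\<lambda>s. fps_nth (A s) k))"

lemma fps_rational_inD: "fps_rational_in D A \<Longrightarrow> rational_in D (\<lambda>s. fps_nth (A s) k)"
  by (simp add: fps_rational_in_def)

lemma fps_rational_in_const [simp]: "fps_rational_in D (\<lambda>_. A)"
  by (simp add: fps_rational_in_def)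

lemma fps_rational_in_mult:
  "fps_rational_in D A \<Longrightarrow> fps_rational_in D B \<Longrightarrow> fps_rational_in D (\<lambda>s. A s * B s)"
  unfolding fps_rational_in_def fps_mult_nth by (auto intro!: rational_in_sum rational_in_mult)

lemma fps_rational_in_power: "fps_rational_in D A \<Longrightarrow> fps_rational_in D (\<lambda>s. A s ^ k)"
  by (induction k) (auto intro: fps_rational_in_mult)

lemma fps_rational_in_prod:
  "(\<And>x. x \<in> S \<Longrightarrow> fps_rational_in D (A x)) \<Longrightarrow> fps_rational_in D (\<lambda>s. \<Prod>x\<in>S. A x s)"
  by (induction S rule: infinite_finite_induct) (auto intro: fps_rational_in_mult)

lemma fps_rational_in_subst_series:
  assumes "\<And>i. fps_rational_in D (\<lambda>s. \<phi> s $ i)"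
  shows "fps_rational_in D (\<lambda>s. subst_series c (\<phi> s))"
  unfolding fps_rational_in_def subst_series_def fps_nth_Abs_fps using assms
  by (intro allI rational_in_sum rational_in_mult rational_in_const fps_rational_inD
      fps_rational_in_prod fps_rational_in_power)

lemma fps_rational_in_shift: "fps_rational_in D A \<Longrightarrow> fps_rational_in D (\<lambda>s. fps_shift n (A s))"
  by (simp add: fps_rational_in_def)

lemma fps_rational_in_inverse:
  assumes "fps_rational_in D A" "\<And>s. fps_nth (A s) 0 = poly D s"
  shows "fps_rational_in D (\<lambda>s. inverse (A s))"
proof -
  have "rational_in D (\<lambda>s. fps_nth (inverse (A s)) k)" for k
  proof (induction k rule: less_induct)
    case (less k)
    show ?case
    proof (cases k)
      case 0
      then show ?thesis using assms(2) rational_in_inverse by simp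
    next
      case (Suc j)
      have "fps_nth (inverse (A s)) k =
          inverse (poly D s) * ((- 1) * (\<Sum>i = 1..k. fps_nth (A s) i * fps_nth (inverse (A s)) (k - i)))" for s
        by (simp only: fps_inverse_def Suc assms(2) fps_nth_Abs_fps fps_right_inverse_constructor.simps
            mult_1_left mult_minus_left mult_minus_right)
      moreover have "rational_in D (\<lambda>s. inverse (poly D s) *
          ((- 1) * (\<Sum>i = 1..k. fps_nth (A s) i * fps_nth (inverse (A s)) (k - i))))"
        by (intro rational_in_mult rational_in_inverse rational_in_const rational_in_sum
            fps_rational_inD[OF assms(1)] less.IH) auto
      ultimately show ?thesis by simp
    qed
  qed
  then show ?thesis by (simp add: fps_rational_in_def)
qed

lemma rational_in_1_imp_poly:
  assumes "rational_in 1 g"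
  obtains p where "g = poly p"
  using assms unfolding rational_in_def by (auto simp: fun_eq_iff)

text \<open>The localisation of \<open>\<complex>[s]\<close> at \<open>D\<close> has no zero divisors.\<close>

lemma rational_in_nonzero_together:
  fixes g :: "'i \<Rightarrow> complex \<Rightarrow> complex"
  assumes "finite I" "\<And>i. i \<in> I \<Longrightarrow> rational_in D (g i)"
    "\<And>i. i \<in> I \<Longrightarrow> poly D (s i) \<noteq> 0 \<and> g i (s i) \<noteq> 0" "D \<noteq> 0"
  obtains t where "poly D t \<noteq> 0" "\<And>i. i \<in> I \<Longrightarrow> g i t \<noteq> 0"
proof -
  have "\<exists>p. \<forall>i\<in>I. p i \<noteq> 0 \<and> (\<forall>t. poly D t \<noteq> 0 \<longrightarrow> poly (p i) t \<noteq> 0 \<longrightarrow> g i t \<noteq> 0)"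
  proof (intro bchoice ballI)
    fix i assume "i \<in> I"
    then obtain k p where p: "\<And>s. poly D s \<noteq> 0 \<Longrightarrow> g i s * poly D s ^ k = poly p s"
      using assms(2)[of i] unfolding rational_in_def by blast
    then have "poly p (s i) \<noteq> 0"
      using assms(3)[OF \<open>i \<in> I\<close>] by (metis mult_eq_0_iff power_not_zero)
    then have "p \<noteq> 0" by auto
    moreover have "g i t \<noteq> 0" if "poly D t \<noteq> 0" "poly p t \<noteq> 0" for t
      using p[OF that(1)] that(2) by auto
    ultimately show "\<exists>p. p \<noteq> 0 \<and> (\<forall>t. poly D t \<noteq> 0 \<longrightarrow> poly p t \<noteq> 0 \<longrightarrow> g i t \<noteq> 0)" by blast
  qed
  then obtain p where p: "\<And>i. i \<in> I \<Longrightarrow> p i \<noteq> 0"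
    "\<And>i t. i \<in> I \<Longrightarrow> poly D t \<noteq> 0 \<Longrightarrow> poly (p i) t \<noteq> 0 \<Longrightarrow> g i t \<noteq> 0"
    by blast
  have "D * (\<Prod>i\<in>I. p i) \<noteq> 0" using p(1) assms(1,4) by simp
  then obtain t where "poly (D * (\<Prod>i\<in>I. p i)) t \<noteq> 0"
    using poly_all_0_iff_0 by blast
  then show ?thesis
    using that[of t] p(2) assms(1) by (auto simp: poly_prod)
qed

lemma fps_rational_in_affine: "fps_rational_in D (\<lambda>s. A + fps_const s * B)"
  unfolding fps_rational_in_def
proof
  fix k
  have "(\<lambda>s. fps_nth (A + fps_const s * B) k) = poly [:fps_nth A k, fps_nth B k:]"
    by (simp add: fun_eq_iff)
  then show "rational_in D (\<lambda>s. fps_nth (A + fps_const s * B) k)"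
    by (metis rational_in_poly)
qed

lemma rational_in_1_tendsto:
  assumes "rational_in 1 g"
  shows "(g \<longlongrightarrow> g 0) (at 0)"
proof -
  obtain p where "g = poly p" by (rule rational_in_1_imp_poly[OF assms])
  then show ?thesis using poly_isCont[of 0 p] by (simp add: isCont_def)
qed

lemma rational_in_1_eventually_nonzero:
  assumes "rational_in 1 g" "g t \<noteq> 0"
  shows "eventually (\<lambda>s. g s \<noteq> 0) (at 0)"
proof -
  obtain p where p: "g = poly p" by (rule rational_in_1_imp_poly[OF assms(1)])
  then have "p \<noteq> 0" using assms(2) by auto
  then have "open (- ({s. poly p s = 0} - {0}))"
    by (intro open_Compl finite_imp_closed finite_Diff poly_roots_finite)
  then show ?thesis
    unfolding eventually_at_topological p
    by (intro exI[of _ "- ({s. poly p s = 0} - {0})"]) auto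
qed

text \<open>A polynomial involves only finitely many variables, so convergence of these coordinates
  suffices. For arcs this means that only finitely many coefficients of the series matter.\<close>

lemma cpoly_eval_tendsto:
  fixes h :: "'v cpoly"
  shows "\<exists>V. finite V \<and> (\<forall>(F :: 's filter) \<sigma> \<tau>. (\<forall>v\<in>V. ((\<lambda>s. \<sigma> s v) \<longlongrightarrow> \<tau> v) F) \<longrightarrow>
      ((\<lambda>s. cpoly_eval (\<sigma> s) h) \<longlongrightarrow> cpoly_eval \<tau> h) F)"
proof (induction h rule: cpoly_induct)
  case (const a)
  show ?case by (intro exI[of _ "{}"]) simp
next
  case (var v)
  show ?case by (intro exI[of _ "{v}"]) simp
next
  case (add p q)
  obtain V where V: "finite V" "\<forall>(F :: 's filter) \<sigma> \<tau>. (\<forall>v\<in>V. ((\<lambda>s. \<sigma> s v) \<longlongrightarrow> \<tau> v) F) \<longrightarrow>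
      ((\<lambda>s. cpoly_eval (\<sigma> s) p) \<longlongrightarrow> cpoly_eval \<tau> p) F"
    using add(1) by (elim exE conjE)
  obtain W where W: "finite W" "\<forall>(F :: 's filter) \<sigma> \<tau>. (\<forall>v\<in>W. ((\<lambda>s. \<sigma> s v) \<longlongrightarrow> \<tau> v) F) \<longrightarrow>
      ((\<lambda>s. cpoly_eval (\<sigma> s) q) \<longlongrightarrow> cpoly_eval \<tau> q) F"
    using add(2) by (elim exE conjE)
  show ?case
    using V W by (intro exI[of _ "V \<union> W"]) (simp add: tendsto_add)
next
  case (mult p q)
  obtain V where V: "finite V" "\<forall>(F :: 's filter) \<sigma> \<tau>. (\<forall>v\<in>V. ((\<lambda>s. \<sigma> s v) \<longlongrightarrow> \<tau> v) F) \<longrightarrow>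
      ((\<lambda>s. cpoly_eval (\<sigma> s) p) \<longlongrightarrow> cpoly_eval \<tau> p) F"
    using mult(1) by (elim exE conjE)
  obtain W where W: "finite W" "\<forall>(F :: 's filter) \<sigma> \<tau>. (\<forall>v\<in>W. ((\<lambda>s. \<sigma> s v) \<longlongrightarrow> \<tau> v) F) \<longrightarrow>
      ((\<lambda>s. cpoly_eval (\<sigma> s) q) \<longlongrightarrow> cpoly_eval \<tau> q) F"
    using mult(2) by (elim exE conjE)
  show ?case
    using V W by (intro exI[of _ "V \<union> W"]) (simp add: tendsto_mult)
qed

fun arc_var_index :: "'n arc_var \<Rightarrow> nat" where
  "arc_var_index (Psi1 k) = k"
| "arc_var_index (Psi2 k) = k"
| "arc_var_index (Phi i k) = k"

section \<open>The strata of arcs with prescribed orders\<close>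

locale function_of_multiplicity =
  fixes f :: "complex ^ 'n \<Rightarrow> complex" and m :: nat
  assumes taylor_coeff_low: "taylor_coeff f \<alpha> \<noteq> 0 \<Longrightarrow> m \<le> mdegree \<alpha>"
    and taylor_coeff_leading: "\<exists>\<alpha>. taylor_coeff f \<alpha> \<noteq> 0 \<and> mdegree \<alpha> = m"
    and multiplicity_ge_2: "m \<ge> 2"
begin

lemma leading_form_somewhere_nonzero:
  obtains z where "leading_form (taylor_coeff f) m z \<noteq> 0"
proof -
  obtain \<alpha> where "taylor_coeff f \<alpha> \<noteq> 0" "mdegree \<alpha> = m"
    using taylor_coeff_leading by blast
  then show ?thesis by (rule leading_form_nonzero) (rule that)
qed

text \<open>\<open>t\<^sup>-\<^sup>m F(\<phi>)\<close>, which is a power series with constant term the leading form of \<open>F\<close> at the linear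
  coefficients of \<open>\<phi>\<close>.\<close>

definition reduced_compose :: "complex fps ^ 'n \<Rightarrow> complex fps" where
  "reduced_compose \<phi> = fps_shift m (compose_arc f \<phi>)"

lemma compose_arc_eq:
  assumes "\<And>i. fps_nth (\<phi> $ i) 0 = 0"
  shows "compose_arc f \<phi> = fps_X ^ m * reduced_compose \<phi>"
  using subst_series_nth_less[OF taylor_coeff_low assms]
  by (intro fps_ext) (simp add: reduced_compose_def fps_X_power_mult_nth)

lemma reduced_compose_nth_0:
  assumes "\<And>i. fps_nth (\<phi> $ i) 0 = 0"
  shows "fps_nth (reduced_compose \<phi>) 0 = leading_form (taylor_coeff f) m (\<lambda>i. fps_nth (\<phi> $ i) 1)"
  using subst_series_nth_leading[OF taylor_coeff_low assms] by (simp add: reduced_compose_def)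

definition stratum :: "nat \<Rightarrow> 'n arc set" where
  "stratum i = {(\<psi>1, \<psi>2, \<phi>) \<in> formal_arcs f. subdegree \<psi>1 = i \<and> subdegree \<psi>2 = m - i}"

text \<open>The parametrisation of the \<open>i\<close>-th stratum by \<open>u = t\<^sup>-\<^sup>i \<psi>\<^sub>1\<close> and \<open>\<phi>\<close>.\<close>

definition stratum_arc :: "nat \<Rightarrow> complex fps \<Rightarrow> complex fps ^ 'n \<Rightarrow> 'n arc" where
  "stratum_arc i u \<phi> = (fps_X ^ i * u, fps_X ^ (m - i) * (reduced_compose \<phi> * inverse u), \<phi>)"

lemma stratum_arc_in_stratum:
  assumes "0 < i" "i < m" "\<And>j. fps_nth (\<phi> $ j) 0 = 0" "fps_nth u 0 \<noteq> 0"
    "fps_nth (reduced_compose \<phi>) 0 \<noteq> 0"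
  shows "stratum_arc i u \<phi> \<in> stratum i"
proof -
  have sub: "subdegree (fps_X ^ k * A) = k" if "fps_nth A 0 \<noteq> 0" for A :: "complex fps" and k
    using that by (intro subdegreeI) (simp_all add: fps_X_power_mult_nth)
  have "(fps_X ^ i * u) * (fps_X ^ (m - i) * (reduced_compose \<phi> * inverse u)) =
      (fps_X ^ i * fps_X ^ (m - i)) * reduced_compose \<phi> * (inverse u * u)"
    by (simp only: mult_ac)
  also have "\<dots> = compose_arc f \<phi>"
    using assms by (simp add: inverse_mult_eq_1 compose_arc_eq flip: power_add)
  finally show ?thesis
    using assms by (auto simp: stratum_def stratum_arc_def formal_arcs_def sub fps_X_power_mult_nth)
qed

lemma formal_arc_factors:
  assumes "(\<psi>1, \<psi>2, \<phi>) \<in> formal_arcs f" "i \<le> m"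
    "\<And>k. k < i \<Longrightarrow> fps_nth \<psi>1 k = 0" "\<And>k. k < m - i \<Longrightarrow> fps_nth \<psi>2 k = 0"
  shows "\<psi>1 = fps_X ^ i * fps_shift i \<psi>1" "\<psi>2 = fps_X ^ (m - i) * fps_shift (m - i) \<psi>2"
    "fps_shift i \<psi>1 * fps_shift (m - i) \<psi>2 = reduced_compose \<phi>"
proof -
  show 1: "\<psi>1 = fps_X ^ i * fps_shift i \<psi>1" and 2: "\<psi>2 = fps_X ^ (m - i) * fps_shift (m - i) \<psi>2"
    using assms(3,4) by (auto intro!: fps_ext simp: fps_X_power_mult_nth)
  have "fps_X ^ m * (fps_shift i \<psi>1 * fps_shift (m - i) \<psi>2) =
      (fps_X ^ i * fps_shift i \<psi>1) * (fps_X ^ (m - i) * fps_shift (m - i) \<psi>2)"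
    using assms(2) by (simp add: mult_ac flip: power_add)
  also have "\<dots> = \<psi>1 * \<psi>2" by (simp flip: 1 2)
  also have "\<dots> = fps_X ^ m * reduced_compose \<phi>"
    using assms(1) by (auto simp: formal_arcs_def compose_arc_eq)
  finally show "fps_shift i \<psi>1 * fps_shift (m - i) \<psi>2 = reduced_compose \<phi>"
    by simp
qed

lemma stratum_nonempty:
  assumes "0 < i" "i < m"
  obtains a where "a \<in> stratum i"
proof -
  obtain z where z: "leading_form (taylor_coeff f) m z \<noteq> 0"
    by (rule leading_form_somewhere_nonzero)
  let ?\<phi> = "\<chi> j. fps_const (z j) * fps_X"
  have "stratum_arc i 1 ?\<phi> \<in> stratum i"
    using assms z by (intro stratum_arc_in_stratum) (simp_all add: reduced_compose_nth_0)
  then show ?thesis by (rule that)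
qed

definition stratum_ideal :: "nat \<Rightarrow> 'n arc_var cpoly set" where
  "stratum_ideal i = {p. \<forall>a\<in>stratum i. cpoly_eval (arc_coord a) p = 0}"

lemma fps_rational_in_reduced_compose:
  "(\<And>j. fps_rational_in D (\<lambda>s. \<phi> s $ j)) \<Longrightarrow> fps_rational_in D (\<lambda>s. reduced_compose (\<phi> s))"
  unfolding reduced_compose_def by (intro fps_rational_in_shift fps_rational_in_subst_series)

lemma stratum_factors:
  assumes "(\<psi>1, \<psi>2, \<phi>) \<in> stratum i" "0 < i" "i < m"
  shows "(\<psi>1, \<psi>2, \<phi>) = stratum_arc i (fps_shift i \<psi>1) \<phi>"
    "fps_nth (fps_shift i \<psi>1) 0 \<noteq> 0" "fps_nth (reduced_compose \<phi>) 0 \<noteq> 0"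
    "fps_nth (\<phi> $ j) 0 = 0"
proof -
  have arc: "(\<psi>1, \<psi>2, \<phi>) \<in> formal_arcs f" and sub: "subdegree \<psi>1 = i" "subdegree \<psi>2 = m - i"
    using assms(1) by (auto simp: stratum_def)
  show "fps_nth (\<phi> $ j) 0 = 0" using arc by (simp add: formal_arcs_def)
  have "\<psi>1 \<noteq> 0" "\<psi>2 \<noteq> 0" using sub assms(2,3) by auto
  then have v: "fps_nth (fps_shift (m - i) \<psi>2) 0 \<noteq> 0"
    using sub nth_subdegree_nonzero[of \<psi>2] by simp
  show u: "fps_nth (fps_shift i \<psi>1) 0 \<noteq> 0"
    using \<open>\<psi>1 \<noteq> 0\<close> sub nth_subdegree_nonzero[of \<psi>1] by simp
  have low: "fps_nth \<psi>1 k = 0" if "k < i" for k using sub that by (intro nth_less_subdegree_zero) simp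
  have low': "fps_nth \<psi>2 k = 0" if "k < m - i" for k using sub that by (intro nth_less_subdegree_zero) simp
  note factors = formal_arc_factors[OF arc less_imp_le[OF assms(3)] low low']
  show "fps_nth (reduced_compose \<phi>) 0 \<noteq> 0"
    using u v by (simp flip: factors(3))
  have "reduced_compose \<phi> * inverse (fps_shift i \<psi>1) =
      (fps_shift i \<psi>1 * fps_shift (m - i) \<psi>2) * inverse (fps_shift i \<psi>1)"
    by (simp only: factors(3))
  also have "\<dots> = fps_shift (m - i) \<psi>2 * (inverse (fps_shift i \<psi>1) * fps_shift i \<psi>1)"
    by (simp only: mult_ac)
  also have "\<dots> = fps_shift (m - i) \<psi>2"
    by (simp only: inverse_mult_eq_1[OF u] mult_1_right)
  finally show "(\<psi>1, \<psi>2, \<phi>) = stratum_arc i (fps_shift i \<psi>1) \<phi>"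
    unfolding stratum_arc_def by (simp flip: factors(1,2))
qed

text \<open>The two arcs are joined by the line through their parameters \<open>(u, \<phi>)\<close>. Along it the
  coefficients of the arc are rational, with denominators powers of the constant term \<open>D\<close> of
  \<open>u\<close>. The values of \<open>g\<close> and \<open>h\<close> and the constant term of \<open>t\<^sup>-\<^sup>m F(\<phi>)\<close>, which keeps the arc in the
  stratum, are rational functions that do not vanish at one of the ends, hence are nonzero at a
  common parameter.\<close>

lemma stratum_irreducible:
  assumes i: "0 < i" "i < m" and a: "a \<in> stratum i" "cpoly_eval (arc_coord a) g \<noteq> 0"
    and b: "b \<in> stratum i" "cpoly_eval (arc_coord b) h \<noteq> 0"
  obtains e where "e \<in> stratum i" "cpoly_eval (arc_coord e) g \<noteq> 0" "cpoly_eval (arc_coord e) h \<noteq> 0"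
proof -
  obtain \<psi>1 \<psi>2 \<phi> where ea: "a = (\<psi>1, \<psi>2, \<phi>)" by (cases a)
  obtain \<psi>1' \<psi>2' \<phi>' where eb: "b = (\<psi>1', \<psi>2', \<phi>')" by (cases b)
  define u u' where "u = fps_shift i \<psi>1" and "u' = fps_shift i \<psi>1'"
  note fa = stratum_factors[OF a(1)[unfolded ea] i, folded u_def]
  note fb = stratum_factors[OF b(1)[unfolded eb] i, folded u'_def]
  define \<phi>s where "\<phi>s = (\<lambda>s. \<chi> j. \<phi> $ j + fps_const s * (\<phi>' $ j - \<phi> $ j))"
  define us where "us = (\<lambda>s. u + fps_const s * (u' - u))"
  define arc where "arc = (\<lambda>s. stratum_arc i (us s) (\<phi>s s))"
  define D where "D = [:fps_nth u 0, fps_nth u' 0 - fps_nth u 0:]"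
  have us_0: "fps_nth (us s) 0 = poly D s" for s
    by (simp add: us_def D_def)
  have \<phi>s_0: "fps_nth (\<phi>s s $ j) 0 = 0" for s j
    using fa(4) fb(4) by (simp add: \<phi>s_def)
  have "\<phi>s 0 = \<phi>" "\<phi>s 1 = \<phi>'" "us 0 = u" "us 1 = u'"
    by (simp_all add: \<phi>s_def us_def vec_eq_iff)
  then have ends: "arc 0 = a" "arc 1 = b" "reduced_compose (\<phi>s 0) = reduced_compose \<phi>"
    "poly D 0 \<noteq> 0" "poly D 1 \<noteq> 0"
    using fa fb by (simp_all add: arc_def ea eb D_def)
  have rat_\<phi>: "fps_rational_in D (\<lambda>s. \<phi>s s $ j)" for j
    by (simp add: \<phi>s_def fps_rational_in_affine)
  have rat_u: "fps_rational_in D us"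
    by (simp add: us_def fps_rational_in_affine)
  have rat_E: "fps_rational_in D (\<lambda>s. reduced_compose (\<phi>s s))"
    by (rule fps_rational_in_reduced_compose[OF rat_\<phi>])
  have "rational_in D (\<lambda>s. arc_coord (arc s) v)" for v
  proof (cases v)
    case (Psi1 k)
    show ?thesis unfolding Psi1 arc_def stratum_arc_def arc_coord.simps fst_conv
      by (intro fps_rational_inD fps_rational_in_mult rat_u fps_rational_in_const)
  next
    case (Psi2 k)
    show ?thesis unfolding Psi2 arc_def stratum_arc_def arc_coord.simps fst_conv snd_conv
      by (intro fps_rational_inD fps_rational_in_mult rat_E fps_rational_in_const
          fps_rational_in_inverse rat_u us_0)
  next
    case (Phi j k)
    show ?thesis unfolding Phi arc_def stratum_arc_def arc_coord.simps snd_conv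
      by (intro fps_rational_inD rat_\<phi>)
  qed
  then have rat_eval: "rational_in D (\<lambda>s. cpoly_eval (arc_coord (arc s)) p)" for p
    by (rule rational_in_cpoly_eval)
  \<comment> \<open>Nonvanishing of the second factor keeps the order of \<open>\<psi>\<^sub>2\<close> at \<open>m - i\<close>.\<close>
  define G where "G = (\<lambda>first s. if first
      then cpoly_eval (arc_coord (arc s)) g * fps_nth (reduced_compose (\<phi>s s)) 0
      else cpoly_eval (arc_coord (arc s)) h)"
  obtain t where t: "poly D t \<noteq> 0" "\<And>first. first \<in> UNIV \<Longrightarrow> G first t \<noteq> 0"
  proof (rule rational_in_nonzero_together[of UNIV D G "\<lambda>first. if first then 0 else 1"])
    show "rational_in D (G first)" for first
      by (cases first) (simp_all add: G_def rational_in_mult rat_eval fps_rational_inD[OF rat_E])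
    show "poly D (if first then 0 else 1) \<noteq> 0 \<and> G first (if first then 0 else 1) \<noteq> 0" for first
      using ends fa(3) a(2) b(2) by (simp add: G_def)
    show "D \<noteq> 0" using ends(4) by auto
  qed auto
  have "arc t \<in> stratum i"
    unfolding arc_def using t(1) t(2)[of True] us_0 \<phi>s_0 i
    by (intro stratum_arc_in_stratum) (auto simp: G_def)
  then show ?thesis
    using that[of "arc t"] t(2)[of True] t(2)[of False] by (simp add: G_def)
qed

text \<open>For \<open>s\<close> tending to \<open>0\<close>, arcs in the stratum converge to the given arc in the finitely many
  coefficients that occur in \<open>h\<close>: the linear coefficients of \<open>\<phi>\<close> are moved a
  little towards a vector \<open>z\<close> at which the leading form does not vanish, and \<open>fps_factors_deform\<close> supplies the factors \<open>u'\<close> and \<open>v'\<close>.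
  The product \<open>u' v'\<close> is correct only up to order \<open>N\<close>; this is repaired by taking \<open>E / u'\<close> as second
  factor, which is possible as \<open>u'\<close> is a unit for small \<open>s \<noteq> 0\<close>.\<close>

lemma stratum_dense:
  assumes arc: "(\<psi>1, \<psi>2, \<phi>) \<in> formal_arcs f" and i: "0 < i" "i < m"
    and low: "\<And>k. k < i \<Longrightarrow> fps_nth \<psi>1 k = 0" "\<And>k. k < m - i \<Longrightarrow> fps_nth \<psi>2 k = 0"
    and h: "h \<in> stratum_ideal i"
  shows "cpoly_eval (arc_coord (\<psi>1, \<psi>2, \<phi>)) h = 0"
proof -
  define u v where "u = fps_shift i \<psi>1" and "v = fps_shift (m - i) \<psi>2"
  have factors: "\<psi>1 = fps_X ^ i * u" "\<psi>2 = fps_X ^ (m - i) * v" "u * v = reduced_compose \<phi>"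
    unfolding u_def v_def by (rule formal_arc_factors[OF arc less_imp_le[OF i(2)] low]; assumption)+
  obtain V where V: "finite V"
    "\<forall>(F :: complex filter) \<sigma> \<tau>. (\<forall>v\<in>V. ((\<lambda>s. \<sigma> s v) \<longlongrightarrow> \<tau> v) F) \<longrightarrow>
      ((\<lambda>s. cpoly_eval (\<sigma> s) h) \<longlongrightarrow> cpoly_eval \<tau> h) F"
    using cpoly_eval_tendsto[of h] by (elim exE conjE)
  \<comment> \<open>The variable with index \<open>k\<close> stands for the coefficient of \<open>t\<^sup>k\<^sup>+\<^sup>1\<close>, hence \<open>Suc\<close>.\<close>
  define N where "N = Suc (Max (insert 0 (arc_var_index ` V)))"
  have N: "Suc (arc_var_index x) \<le> N" if "x \<in> V" for x
    using V(1) that by (simp add: N_def)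
  obtain z where z: "leading_form (taylor_coeff f) m z \<noteq> 0"
    by (rule leading_form_somewhere_nonzero)
  define \<phi>s where "\<phi>s = (\<lambda>s. \<chi> j. \<phi> $ j + fps_const s * (fps_const (z j - fps_nth (\<phi> $ j) 1) * fps_X))"
  define E where "E = (\<lambda>s. reduced_compose (\<phi>s s))"
  have \<phi>_0: "fps_nth (\<phi> $ j) 0 = 0" for j using arc by (simp add: formal_arcs_def)
  then have \<phi>s_0: "fps_nth (\<phi>s s $ j) 0 = 0" for s j by (simp add: \<phi>s_def)
  have "\<phi>s 0 = \<phi>" by (simp add: \<phi>s_def vec_eq_iff)
  then have E_0: "E 0 = u * v" using factors(3) by (simp add: E_def)
  have rat_\<phi>: "fps_rational_in 1 (\<lambda>s. \<phi>s s $ j)" for j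
    by (simp add: \<phi>s_def fps_rational_in_affine)
  have rat_E: "fps_rational_in 1 E"
    unfolding E_def by (rule fps_rational_in_reduced_compose[OF rat_\<phi>])
  have "(\<lambda>j. fps_nth (\<phi>s 1 $ j) 1) = z"
    by (simp add: \<phi>s_def fun_eq_iff)
  then have "fps_nth (E 1) 0 \<noteq> 0"
    using z reduced_compose_nth_0[OF \<phi>s_0, of 1] by (simp add: E_def)
  then have E_nz: "eventually (\<lambda>s. fps_nth (E s) 0 \<noteq> 0) (at 0)"
    by (rule rational_in_1_eventually_nonzero[OF fps_rational_inD[OF rat_E]])
  have E_lim: "((\<lambda>s. fps_nth (E s) k) \<longlongrightarrow> fps_nth (u * v) k) (at 0)" for k
    using rational_in_1_tendsto[OF fps_rational_inD[OF rat_E]] by (simp flip: E_0)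
  obtain u' v' where uv: "\<And>s k. k \<le> N \<Longrightarrow> fps_nth (u' s * v' s) k = fps_nth (E s) k"
    "\<And>k. k \<le> N \<Longrightarrow> ((\<lambda>s. fps_nth (u' s) k) \<longlongrightarrow> fps_nth u k) (at 0)"
    "\<And>k. k \<le> N \<Longrightarrow> ((\<lambda>s. fps_nth (v' s) k) \<longlongrightarrow> fps_nth v k) (at 0)"
    by (rule fps_factors_deform[OF E_lim, where N = N]) (rule that; assumption)
  define arc' where "arc' = (\<lambda>s. stratum_arc i (u' s) (\<phi>s s))"
  have u'_nz: "fps_nth (u' s) 0 \<noteq> 0" if "fps_nth (E s) 0 \<noteq> 0" for s
    using uv(1)[of 0 s] that by auto
  have v'_eq: "fps_nth (E s * inverse (u' s)) k = fps_nth (v' s) k"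
    if "fps_nth (E s) 0 \<noteq> 0" "k \<le> N" for s k
  proof -
    have "fps_nth (E s * inverse (u' s)) k = fps_nth ((u' s * v' s) * inverse (u' s)) k"
      using uv(1) that(2) by (intro fps_mult_nth_cong) auto
    also have "(u' s * v' s) * inverse (u' s) = v' s * (inverse (u' s) * u' s)"
      by (simp only: mult_ac)
    also have "\<dots> = v' s"
      by (simp only: inverse_mult_eq_1[OF u'_nz[OF that(1)]] mult_1_right)
    finally show ?thesis .
  qed
  have "((\<lambda>s. arc_coord (arc' s) x) \<longlongrightarrow> arc_coord (\<psi>1, \<psi>2, \<phi>) x) (at 0)" if "x \<in> V" for x
  proof (cases x)
    case (Psi1 k)
    have "((\<lambda>s. if Suc k < i then 0 else fps_nth (u' s) (Suc k - i)) \<longlongrightarrow>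
        (if Suc k < i then 0 else fps_nth u (Suc k - i))) (at 0)"
      using uv(2)[of "Suc k - i"] N[OF that] Psi1 by auto
    moreover have "fps_nth \<psi>1 (Suc k) = (if Suc k < i then 0 else fps_nth u (Suc k - i))"
      by (subst factors(1)) (rule fps_X_power_mult_nth)
    ultimately show ?thesis
      by (simp add: Psi1 arc'_def stratum_arc_def fps_X_power_mult_nth)
  next
    case (Psi2 k)
    have lim: "((\<lambda>s. if Suc k < m - i then 0 else fps_nth (v' s) (Suc k - (m - i))) \<longlongrightarrow>
        (if Suc k < m - i then 0 else fps_nth v (Suc k - (m - i)))) (at 0)"
      using uv(3)[of "Suc k - (m - i)"] N[OF that] Psi2 by auto
    have coeff: "arc_coord (\<psi>1, \<psi>2, \<phi>) x = (if Suc k < m - i then 0 else fps_nth v (Suc k - (m - i)))"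
      unfolding Psi2 arc_coord.simps fst_conv snd_conv by (subst factors(2)) (rule fps_X_power_mult_nth)
    have "eventually (\<lambda>s. (if Suc k < m - i then 0 else fps_nth (v' s) (Suc k - (m - i))) =
        arc_coord (arc' s) x) (at 0)"
      using E_nz
    proof eventually_elim
      case (elim s)
      then show ?case
        using v'_eq[OF elim, of "Suc k - (m - i)"] N[OF that]
        by (simp add: Psi2 arc'_def stratum_arc_def fps_X_power_mult_nth E_def)
    qed
    then show ?thesis unfolding coeff by (rule Lim_transform_eventually[OF lim])
  next
    case (Phi j k)
    then show ?thesis
      using rational_in_1_tendsto[OF fps_rational_inD[OF rat_\<phi>], of j "Suc k"] \<open>\<phi>s 0 = \<phi>\<close>
      by (simp add: arc'_def stratum_arc_def)
  qed
  then have "((\<lambda>s. cpoly_eval (arc_coord (arc' s)) h) \<longlongrightarrow> cpoly_eval (arc_coord (\<psi>1, \<psi>2, \<phi>)) h) (at 0)"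
    by (intro V(2)[rule_format])
  note lim = this
  have "eventually (\<lambda>s. cpoly_eval (arc_coord (arc' s)) h = 0) (at 0)"
    using E_nz
  proof eventually_elim
    case (elim s)
    then have "arc' s \<in> stratum i"
      unfolding arc'_def using u'_nz \<phi>s_0 i by (intro stratum_arc_in_stratum) (auto simp: E_def)
    then show ?case using h by (simp add: stratum_ideal_def)
  qed
  then show ?thesis
    by (rule tendsto_unique[OF trivial_limit_at lim tendsto_eventually])
qed

end

section \<open>The components of the arc space\<close>

lemma multiplicity_at_origin_enatD:
  assumes "multiplicity_at_origin f = enat m"
  shows "taylor_coeff f \<alpha> \<noteq> 0 \<Longrightarrow> m \<le> mdegree \<alpha>"
    and "\<exists>\<alpha>. taylor_coeff f \<alpha> \<noteq> 0 \<and> mdegree \<alpha> = m"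
proof -
  let ?D = "(\<lambda>\<alpha>. enat (mdegree \<alpha>)) ` {\<alpha>. taylor_coeff f \<alpha> \<noteq> 0}"
  have Inf: "Inf ?D = enat m" using assms by (simp add: multiplicity_at_origin_def)
  show "m \<le> mdegree \<alpha>" if "taylor_coeff f \<alpha> \<noteq> 0"
  proof -
    have "Inf ?D \<le> enat (mdegree \<alpha>)" using that by (intro Inf_lower) auto
    then show ?thesis by (simp add: Inf)
  qed
  have "?D \<noteq> {}"
  proof
    assume "?D = {}"
    then have "Inf ?D = \<infinity>" by (simp add: Inf_enat_def)
    then show False by (simp add: Inf)
  qed
  then have "Inf ?D \<in> ?D"
    unfolding Inf_enat_def by (auto intro: LeastI)
  then show "\<exists>\<alpha>. taylor_coeff f \<alpha> \<noteq> 0 \<and> mdegree \<alpha> = m"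
    unfolding Inf by auto
qed

context function_of_multiplicity
begin

abbreviation arc_relations :: "'n arc_var cpoly set" where
  "arc_relations \<equiv> range (fps_nth (arc_equation f))"

lemma stratum_subset: "stratum i \<subseteq> formal_arcs f"
  by (auto simp: stratum_def)

lemma stratum_idealD: "p \<in> stratum_ideal i \<Longrightarrow> a \<in> stratum i \<Longrightarrow> cpoly_eval (arc_coord a) p = 0"
  by (simp add: stratum_ideal_def)

lemma stratum_coords:
  assumes "a \<in> stratum i" "0 < i" "i < m"
  shows "Suc k < i \<Longrightarrow> arc_coord a (Psi1 k) = 0"
    "Suc k < m - i \<Longrightarrow> arc_coord a (Psi2 k) = 0"
    "arc_coord a (Psi1 (i - 1)) \<noteq> 0" "arc_coord a (Psi2 (m - i - 1)) \<noteq> 0"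
proof -
  obtain \<psi>1 \<psi>2 \<phi> where a: "a = (\<psi>1, \<psi>2, \<phi>)" by (cases a)
  have sub: "subdegree \<psi>1 = i" "subdegree \<psi>2 = m - i"
    using assms(1) by (auto simp: a stratum_def)
  then have "\<psi>1 \<noteq> 0" "\<psi>2 \<noteq> 0" using assms by auto
  then show "arc_coord a (Psi1 (i - 1)) \<noteq> 0" "arc_coord a (Psi2 (m - i - 1)) \<noteq> 0"
    using sub assms nth_subdegree_nonzero[of \<psi>1] nth_subdegree_nonzero[of \<psi>2]
    by (simp_all add: a Suc_diff_Suc)
  show "arc_coord a (Psi1 k) = 0" if "Suc k < i"
    unfolding a arc_coord.simps fst_conv using that sub(1) by (intro nth_less_subdegree_zero) simp
  show "arc_coord a (Psi2 k) = 0" if "Suc k < m - i"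
    unfolding a arc_coord.simps fst_conv snd_conv using that sub(2) by (intro nth_less_subdegree_zero) simp
qed

lemma Psi1_in_stratum_ideal: "0 < i \<Longrightarrow> i < m \<Longrightarrow> Suc k < i \<Longrightarrow> cpoly_var (Psi1 k) \<in> stratum_ideal i"
  unfolding stratum_ideal_def mem_Collect_eq cpoly_eval_var by (intro ballI stratum_coords(1))

lemma Psi2_in_stratum_ideal: "0 < i \<Longrightarrow> i < m \<Longrightarrow> Suc k < m - i \<Longrightarrow> cpoly_var (Psi2 k) \<in> stratum_ideal i"
  unfolding stratum_ideal_def mem_Collect_eq cpoly_eval_var by (intro ballI stratum_coords(2))

lemma leading_notin_stratum_ideal:
  assumes "0 < i" "i < m"
  shows "cpoly_var (Psi1 (i - 1)) \<notin> stratum_ideal i" "cpoly_var (Psi2 (m - i - 1)) \<notin> stratum_ideal i"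
proof -
  obtain a where a: "a \<in> stratum i" by (rule stratum_nonempty[OF assms])
  show "cpoly_var (Psi1 (i - 1)) \<notin> stratum_ideal i"
    using stratum_idealD[OF _ a] stratum_coords(3)[OF a assms] by fastforce
  show "cpoly_var (Psi2 (m - i - 1)) \<notin> stratum_ideal i"
    using stratum_idealD[OF _ a] stratum_coords(4)[OF a assms] by fastforce
qed

lemma stratum_ideal_in_arc_space:
  assumes "0 < i" "i < m"
  shows "stratum_ideal i \<in> spec_points arc_relations"
proof -
  have "prime_ideal (stratum_ideal i)"
    unfolding prime_ideal_def
  proof (intro conjI allI ballI impI)
    obtain a where a: "a \<in> stratum i" by (rule stratum_nonempty[OF assms])
    show "1 \<notin> stratum_ideal i"
      using stratum_idealD[OF _ a, of 1] by auto
  next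
    fix g h assume gh: "g * h \<in> stratum_ideal i"
    show "g \<in> stratum_ideal i \<or> h \<in> stratum_ideal i"
    proof (rule ccontr)
      assume "\<not> (g \<in> stratum_ideal i \<or> h \<in> stratum_ideal i)"
      then obtain a b where ab: "a \<in> stratum i" "cpoly_eval (arc_coord a) g \<noteq> 0"
        "b \<in> stratum i" "cpoly_eval (arc_coord b) h \<noteq> 0"
        unfolding stratum_ideal_def by (auto simp del: arc_coord.simps)
      obtain e where e: "e \<in> stratum i" "cpoly_eval (arc_coord e) g \<noteq> 0" "cpoly_eval (arc_coord e) h \<noteq> 0"
        by (rule stratum_irreducible[OF assms ab])
      show False using stratum_idealD[OF gh e(1)] e(2,3) by simp
    qed
  qed (simp_all add: stratum_ideal_def)
  moreover have "arc_relations \<subseteq> stratum_ideal i"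
  proof
    fix p assume p: "p \<in> arc_relations"
    have "cpoly_eval (arc_coord a) p = 0" if "a \<in> stratum i" for a
    proof -
      have "arc_point a \<in> spec_points arc_relations"
        by (rule arc_point_in_arc_space[OF subsetD[OF stratum_subset that]])
      then have "p \<in> arc_point a" using p unfolding spec_points_def by blast
      then show ?thesis by (simp add: arc_point_def)
    qed
    then show "p \<in> stratum_ideal i" unfolding stratum_ideal_def mem_Collect_eq by (rule ballI)
  qed
  ultimately show ?thesis by (simp add: spec_points_def)
qed

text \<open>On complex points, the closure of the stratum is given by the evident coefficients: necessity
  because these coefficients belong to the ideal, sufficiency by \<open>stratum_dense\<close>.\<close>

lemma stratum_ideal_subset_arc_point_iff:
  assumes i: "0 < i" "i < m" and arc: "(\<psi>1, \<psi>2, \<phi>) \<in> formal_arcs f"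
  shows "stratum_ideal i \<subseteq> arc_point (\<psi>1, \<psi>2, \<phi>) \<longleftrightarrow>
    (\<forall>k<i. fps_nth \<psi>1 k = 0) \<and> (\<forall>k<m - i. fps_nth \<psi>2 k = 0)"
proof
  assume sub: "stratum_ideal i \<subseteq> arc_point (\<psi>1, \<psi>2, \<phi>)"
  have zero: "fps_nth \<psi>1 0 = 0" "fps_nth \<psi>2 0 = 0" using arc by (auto simp: formal_arcs_def)
  have "fps_nth \<psi>1 k = 0" if "k < i" for k
  proof (cases k)
    case (Suc j)
    have "cpoly_var (Psi1 j) \<in> arc_point (\<psi>1, \<psi>2, \<phi>)"
      using Psi1_in_stratum_ideal[OF i] that Suc by (intro subsetD[OF sub]) simp
    then show ?thesis by (simp add: arc_point_def Suc)
  qed (use zero in simp)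
  moreover have "fps_nth \<psi>2 k = 0" if "k < m - i" for k
  proof (cases k)
    case (Suc j)
    have "cpoly_var (Psi2 j) \<in> arc_point (\<psi>1, \<psi>2, \<phi>)"
      using Psi2_in_stratum_ideal[OF i] that Suc by (intro subsetD[OF sub]) simp
    then show ?thesis by (simp add: arc_point_def Suc)
  qed (use zero in simp)
  ultimately show "(\<forall>k<i. fps_nth \<psi>1 k = 0) \<and> (\<forall>k<m - i. fps_nth \<psi>2 k = 0)" by simp
next
  assume low: "(\<forall>k<i. fps_nth \<psi>1 k = 0) \<and> (\<forall>k<m - i. fps_nth \<psi>2 k = 0)"
  show "stratum_ideal i \<subseteq> arc_point (\<psi>1, \<psi>2, \<phi>)"
  proof
    fix h assume "h \<in> stratum_ideal i"
    then have "cpoly_eval (arc_coord (\<psi>1, \<psi>2, \<phi>)) h = 0"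
      by (rule stratum_dense[OF arc i, rotated 2]) (simp_all add: low)
    then show "h \<in> arc_point (\<psi>1, \<psi>2, \<phi>)" by (simp add: arc_point_def)
  qed
qed

text \<open>\<open>i\<close> is the order of \<open>\<psi>\<^sub>1\<close> if that is less than \<open>m\<close>; otherwise \<open>i = m - 1\<close> works, because \<open>\<psi>\<^sub>2\<close> has
  positive order.\<close>

lemma formal_arc_in_some_stratum_closure:
  assumes "a \<in> formal_arcs f"
  obtains i where "0 < i" "i < m" "stratum_ideal i \<subseteq> arc_point a"
proof -
  obtain \<psi>1 \<psi>2 \<phi> where a: "a = (\<psi>1, \<psi>2, \<phi>)" by (cases a)
  have zero: "fps_nth \<psi>1 0 = 0" "fps_nth \<psi>2 0 = 0" "\<And>j. fps_nth (\<phi> $ j) 0 = 0"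
    and eq: "\<psi>1 * \<psi>2 = fps_X ^ m * reduced_compose \<phi>"
    using assms compose_arc_eq[of \<phi>] by (auto simp: a formal_arcs_def)
  have "\<exists>i. 0 < i \<and> i < m \<and> (\<forall>k<i. fps_nth \<psi>1 k = 0) \<and> (\<forall>k<m - i. fps_nth \<psi>2 k = 0)"
  proof (cases "\<exists>k<m. fps_nth \<psi>1 k \<noteq> 0")
    case True
    define i where "i = subdegree \<psi>1"
    have "\<psi>1 \<noteq> 0" using True by auto
    have "i \<noteq> 0" using nth_subdegree_nonzero[OF \<open>\<psi>1 \<noteq> 0\<close>] zero(1) unfolding i_def by metis
    moreover have "i < m" using True subdegree_leI[of \<psi>1] unfolding i_def by (meson le_less_trans)
    ultimately have i: "0 < i" "i < m" by simp_all
    have "fps_nth \<psi>2 k = 0" if "k < m - i" for k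
    proof (cases "\<psi>2 = 0")
      case False
      have "m \<le> subdegree (\<psi>1 * \<psi>2)"
        using \<open>\<psi>1 \<noteq> 0\<close> False unfolding eq
        by (intro subdegree_geI) (use eq in \<open>auto simp: fps_X_power_mult_nth\<close>)
      also have "\<dots> = i + subdegree \<psi>2" using \<open>\<psi>1 \<noteq> 0\<close> False by (simp add: i_def)
      finally show ?thesis using that by (intro nth_less_subdegree_zero) simp
    qed simp
    moreover have "fps_nth \<psi>1 k = 0" if "k < i" for k
      using that unfolding i_def by (rule nth_less_subdegree_zero)
    ultimately show ?thesis using i by (intro exI[of _ i]) simp
  next
    case False
    then show ?thesis
      using multiplicity_ge_2 zero(2) by (intro exI[of _ "m - 1"]) auto
  qed
  then obtain i where i: "0 < i" "i < m"
    and low: "(\<forall>k<i. fps_nth \<psi>1 k = 0) \<and> (\<forall>k<m - i. fps_nth \<psi>2 k = 0)"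
    by blast
  then have "stratum_ideal i \<subseteq> arc_point a"
    using stratum_ideal_subset_arc_point_iff[OF i assms[unfolded a]] unfolding a by simp
  with i show ?thesis by (rule that)
qed

lemma arc_space_point_in_some_stratum_closure:
  assumes "P \<in> spec_points arc_relations"
  shows "\<exists>i\<in>{0<..<m}. stratum_ideal i \<subseteq> P"
proof (rule ccontr)
  have prime: "prime_ideal P" and rel: "arc_relations \<subseteq> P"
    using assms by (auto simp: spec_points_def)
  assume "\<not> (\<exists>i\<in>{0<..<m}. stratum_ideal i \<subseteq> P)"
  then have "\<forall>i\<in>{0<..<m}. \<exists>h. h \<in> stratum_ideal i \<and> h \<notin> P" by blast
  from bchoice[OF this] obtain h where h: "\<forall>i\<in>{0<..<m}. h i \<in> stratum_ideal i \<and> h i \<notin> P" ..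
  have "(\<Prod>i\<in>{0<..<m}. h i) \<notin> P"
  proof
    assume "(\<Prod>i\<in>{0<..<m}. h i) \<in> P"
    then obtain i where "i \<in> {0<..<m}" "h i \<in> P"
      by (rule prime_ideal_prod_mem[OF prime finite_greaterThanLessThan])
    then show False using h by blast
  qed
  then obtain \<sigma> where \<sigma>: "\<And>p. p \<in> P \<Longrightarrow> cpoly_eval \<sigma> p = 0"
    "cpoly_eval \<sigma> (\<Prod>i\<in>{0<..<m}. h i) \<noteq> 0"
    by (rule nullstellensatz_countable[OF countable_arc_vars prime]) (rule that; assumption)
  have "cpoly_eval \<sigma> (fps_nth (arc_equation f) k) = 0" for k
    using rel by (intro \<sigma>(1)) auto
  then obtain a where a: "a \<in> formal_arcs f" "arc_coord a = \<sigma>"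
    by (rule arc_of_complex_point)
  obtain i where i: "0 < i" "i < m" "stratum_ideal i \<subseteq> arc_point a"
    by (rule formal_arc_in_some_stratum_closure[OF a(1)])
  then have "h i \<in> arc_point a" using h by auto
  then have "cpoly_eval \<sigma> (h i) = 0" by (simp add: arc_point_def a(2))
  moreover have "i \<in> {0<..<m}" using i by simp
  ultimately show False using \<sigma>(2) by auto
qed

lemma stratum_ideal_incomparable:
  assumes "i \<in> {0<..<m}" "j \<in> {0<..<m}" "stratum_ideal i \<subseteq> stratum_ideal j"
  shows "i = j"
proof (rule ccontr)
  assume "i \<noteq> j"
  then consider "j < i" | "i < j" by linarith
  then show False
  proof cases
    case 1
    then have "cpoly_var (Psi1 (j - 1)) \<in> stratum_ideal i"
      using assms by (intro Psi1_in_stratum_ideal) auto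
    then show ?thesis using leading_notin_stratum_ideal(1)[of j] assms by auto
  next
    case 2
    then have "cpoly_var (Psi2 (m - j - 1)) \<in> stratum_ideal i"
      using assms by (intro Psi2_in_stratum_ideal) auto
    then show ?thesis using leading_notin_stratum_ideal(2)[of j] assms by auto
  qed
qed

lemma arc_components:
  "bij_betw (\<lambda>i. vanishing_locus arc_relations (stratum_ideal i)) {0<..<m} (irreducible_components (arc_space f))"
  unfolding arc_space_def
  by (rule irreducible_components_spec_mod)
    (auto intro: stratum_ideal_in_arc_space stratum_ideal_incomparable
      dest: arc_space_point_in_some_stratum_closure)

text \<open>The open set is the locus where the coefficients of \<open>t\<^sup>i\<close> in \<open>\<psi>\<^sub>1\<close> and of \<open>t\<^sup>m\<^sup>-\<^sup>i\<close> in \<open>\<psi>\<^sub>2\<close> are both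
  nonzero. It contains the generic point \<open>stratum_ideal i\<close>, and therefore is dense.\<close>

lemma open_stratum:
  assumes i: "0 < i" "i < m"
  defines "Z \<equiv> vanishing_locus arc_relations (stratum_ideal i)"
  defines "Z\<^sub>0 \<equiv> {P \<in> Z. cpoly_var (Psi1 (i - 1)) * cpoly_var (Psi2 (m - i - 1)) \<notin> P}"
  shows "openin (subtopology (arc_space f) Z) Z\<^sub>0"
    and "subtopology (arc_space f) Z closure_of Z\<^sub>0 = Z"
    and "(\<psi>1, \<psi>2, \<phi>) \<in> formal_arcs f \<Longrightarrow> arc_point (\<psi>1, \<psi>2, \<phi>) \<in> Z\<^sub>0 \<longleftrightarrow>
      subdegree \<psi>1 = i \<and> subdegree \<psi>2 = m - i \<and> subdegree (compose_arc f \<phi>) = m"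
proof -
  let ?d = "cpoly_var (Psi1 (i - 1)) * cpoly_var (Psi2 (m - i - 1)) :: 'n arc_var cpoly"
  have Z: "Z \<subseteq> spec_points arc_relations" by (auto simp: Z_def)
  have "openin (arc_space f) {P \<in> spec_points arc_relations. \<not> {?d} \<subseteq> P}"
    unfolding arc_space_def openin_spec_mod by blast
  moreover have "Z\<^sub>0 = {P \<in> spec_points arc_relations. \<not> {?d} \<subseteq> P} \<inter> Z"
    using Z by (auto simp: Z\<^sub>0_def)
  ultimately show "openin (subtopology (arc_space f) Z) Z\<^sub>0"
    unfolding openin_subtopology by blast
  have top: "topspace (arc_space f) = spec_points arc_relations"
    by (simp add: arc_space_def topspace_spec_mod)
  have point: "stratum_ideal i \<in> spec_points arc_relations"
    by (rule stratum_ideal_in_arc_space[OF i])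
  have "?d \<notin> stratum_ideal i"
  proof
    assume "?d \<in> stratum_ideal i"
    moreover have "prime_ideal (stratum_ideal i)" using point by (simp add: spec_points_def)
    ultimately have "cpoly_var (Psi1 (i - 1)) \<in> stratum_ideal i \<or>
        cpoly_var (Psi2 (m - i - 1)) \<in> stratum_ideal i"
      by (rule prime_idealD(6)[rotated])
    then show False using leading_notin_stratum_ideal[OF i] by blast
  qed
  then have generic: "stratum_ideal i \<in> Z\<^sub>0"
    using point by (simp add: Z\<^sub>0_def Z_def)
  have "Z \<subseteq> arc_space f closure_of Z\<^sub>0"
    unfolding Z_def arc_space_def
  proof (rule closedin_contains_vanishing_locus)
    show "closedin (spec_mod arc_relations) (spec_mod arc_relations closure_of Z\<^sub>0)"
      by (rule closedin_closure_of)
    show "stratum_ideal i \<in> spec_mod arc_relations closure_of Z\<^sub>0"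
    proof (rule subsetD[OF closure_of_subset generic])
      show "Z\<^sub>0 \<subseteq> topspace (spec_mod arc_relations)"
        using Z by (auto simp: topspace_spec_mod Z\<^sub>0_def)
    qed
  qed
  moreover have "Z \<inter> Z\<^sub>0 = Z\<^sub>0" by (auto simp: Z\<^sub>0_def)
  ultimately show "subtopology (arc_space f) Z closure_of Z\<^sub>0 = Z"
    unfolding closure_of_subtopology by auto
  assume arc: "(\<psi>1, \<psi>2, \<phi>) \<in> formal_arcs f"
  have "arc_point (\<psi>1, \<psi>2, \<phi>) \<in> Z\<^sub>0 \<longleftrightarrow>
      ((\<forall>k<i. fps_nth \<psi>1 k = 0) \<and> (\<forall>k<m - i. fps_nth \<psi>2 k = 0)) \<and>
      fps_nth \<psi>1 i \<noteq> 0 \<and> fps_nth \<psi>2 (m - i) \<noteq> 0"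
    unfolding stratum_ideal_subset_arc_point_iff[OF i arc, symmetric]
    using arc_point_in_arc_space[OF arc] i by (simp add: Z\<^sub>0_def Z_def arc_point_def Suc_diff_Suc)
  also have "\<dots> \<longleftrightarrow> subdegree \<psi>1 = i \<and> subdegree \<psi>2 = m - i"
  proof -
    have "(\<forall>j<k. fps_nth A j = 0) \<and> fps_nth A k \<noteq> 0 \<longleftrightarrow> subdegree A = k"
      if "0 < k" for A :: "complex fps" and k
      using that nth_subdegree_nonzero[of A] by (auto intro: subdegreeI nth_less_subdegree_zero)
    from this[of i \<psi>1] this[of "m - i" \<psi>2] i show ?thesis by auto
  qed
  also have "\<dots> \<longleftrightarrow> subdegree \<psi>1 = i \<and> subdegree \<psi>2 = m - i \<and> subdegree (compose_arc f \<phi>) = m"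
  proof -
    have "subdegree (\<psi>1 * \<psi>2) = m" if "subdegree \<psi>1 = i" "subdegree \<psi>2 = m - i"
    proof -
      have "\<psi>1 \<noteq> 0" "\<psi>2 \<noteq> 0" using that i by auto
      then show ?thesis using that i by simp
    qed
    moreover have "\<psi>1 * \<psi>2 = compose_arc f \<phi>" using arc by (simp add: formal_arcs_def)
    ultimately show ?thesis by auto
  qed
  finally show "arc_point (\<psi>1, \<psi>2, \<phi>) \<in> Z\<^sub>0 \<longleftrightarrow>
      subdegree \<psi>1 = i \<and> subdegree \<psi>2 = m - i \<and> subdegree (compose_arc f \<phi>) = m" .
qed

end

(* subdegree 0 = 0, but i, m - i and m are positive, so the conditions on subdegree below
   are exactly conditions on the order of vanishing *)
theorem theorem1:
  fixes f :: "complex ^ 'n \<Rightarrow> complex" and U :: "(complex ^ 'n) set" and m :: nat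
  assumes "open U" and "0 \<in> U" and "holomorphic_several_on f U"
    and "multiplicity_at_origin f = enat m" and "m \<ge> 2"
    and "CARD('n) + 1 \<ge> 2" (* dim X = n + 1 *)
  shows "\<exists>Arc :: nat \<Rightarrow> 'n arc_var cpoly set set.
    bij_betw Arc {0<..<m} (irreducible_components (arc_space f)) \<and>
    (\<forall>i\<in>{0<..<m}. \<exists>Arc\<^sub>0.
       openin (subtopology (arc_space f) (Arc i)) Arc\<^sub>0 \<and>
       subtopology (arc_space f) (Arc i) closure_of Arc\<^sub>0 = Arc i \<and>
       (\<forall>\<psi>1 \<psi>2 \<phi>. (\<psi>1, \<psi>2, \<phi>) \<in> formal_arcs f \<longrightarrow>
          (arc_point (\<psi>1, \<psi>2, \<phi>) \<in> Arc\<^sub>0 \<longleftrightarrow>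
             subdegree \<psi>1 = i \<and> subdegree \<psi>2 = m - i \<and> subdegree (compose_arc f \<phi>) = m)))"
proof -
  interpret function_of_multiplicity f m
    using multiplicity_at_origin_enatD[OF assms(4)] assms(5) by unfold_locales
  show ?thesis
  proof (intro exI[of _ "\<lambda>i. vanishing_locus arc_relations (stratum_ideal i)"] conjI ballI)
    fix i assume "i \<in> {0<..<m}"
    then have i: "0 < i" "i < m" by auto
    note open_stratum[OF i]
    then show "\<exists>Arc\<^sub>0.
       openin (subtopology (arc_space f) (vanishing_locus arc_relations (stratum_ideal i))) Arc\<^sub>0 \<and>
       subtopology (arc_space f) (vanishing_locus arc_relations (stratum_ideal i)) closure_of Arc\<^sub>0 =
         vanishing_locus arc_relations (stratum_ideal i) \<and>
       (\<forall>\<psi>1 \<psi>2 \<phi>. (\<psi>1, \<psi>2, \<phi>) \<in> formal_arcs f \<longrightarrow>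
          (arc_point (\<psi>1, \<psi>2, \<phi>) \<in> Arc\<^sub>0 \<longleftrightarrow>
             subdegree \<psi>1 = i \<and> subdegree \<psi>2 = m - i \<and> subdegree (compose_arc f \<phi>) = m))"
      by (intro exI conjI allI impI)
  qed (rule arc_components)
qed

end
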